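(* Let $(\Omega,\mathcal F,\mathbb P)$ be a probability space with a filtration $(\mathcal F_t)_{t\ge 0}$ fulfilling the usual conditions, and let $(X_t)_{t\ge 0}$ be an adapted stochastic process with values in $\mathbb R$. Assume: (E1) for every $t>0$ the probability measure $\mathbb P(X_t\in\cdot\,)$ is diffuse; (E2) $(X_t)_{t\ge 0}$ has $\mathbb P$-a.s. right-continuous paths and is quasi-left-continuous; (E3) for every boundary function $b$ it holds $\mathbb P$-a.s. that $\tau_b=\tau_b'$. Then, given a random variable $\xi$ with values in $(0,\infty)$, there exists a boundary function $b$ such that $\tau_b$ and $\xi$ have the same distribution.
   Context: A probability measure is diffuse if it has no atoms. A boundary function is a lower semicontinuous function $b:[0,\infty]\to[-\infty,\infty]$. For a boundary function $b$, $\tau_b:=\inf\{t>0: X_t\ge b(t)\}$ and $\tau_b':=\inf\{t>0: X_t>b(t)\}$, with $t$ ranging over $(0,\infty)$ and $\inf\emptyset=\infty$. The process $(X_t)_{t\ge0}$ is quasi-left-continuous if for every non-decreasing sequence of stopping times $T_1\le T_2\le\dots$ with $T:=\lim_{n\to\infty}T_n$ one has $\lim_{n\to\infty}X_{T_n}=X_T$ almost surely on $\{T<\infty\}$. *)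

theory Defs
  imports "HOL-Probability.Probability"
begin

text \<open>
  Time runs through the nonnegative reals, so only the values of \<open>F\<close> and \<open>X\<close> at \<open>t \<ge> 0\<close> matter.
  For \<open>F t\<close> only the underlying \<open>\<sigma>\<close>-algebra matters, not the measure it carries.
\<close>

locale usual_conditions = prob_space M + complete_measure M
  for M :: "'a measure" +
  fixes F :: "real \<Rightarrow> 'a measure"
  assumes subalgebra_F: "\<And>t. 0 \<le> t \<Longrightarrow> subalgebra M (F t)"
    and sets_F_mono: "\<And>s t. 0 \<le> s \<Longrightarrow> s \<le> t \<Longrightarrow> sets (F s) \<subseteq> sets (F t)"
    and null_sets_F: "null_sets M \<subseteq> sets (F 0)"
    and right_continuous_F: "\<And>t. 0 \<le> t \<Longrightarrow> sets (F t) = (\<Inter>s\<in>{t<..}. sets (F s))"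

definition adapted :: "(real \<Rightarrow> 'a measure) \<Rightarrow> (real \<Rightarrow> 'a \<Rightarrow> real) \<Rightarrow> bool" where
  "adapted F X \<longleftrightarrow> (\<forall>t\<ge>0. X t \<in> borel_measurable (F t))"

text \<open>
  The library's \<^const>\<open>stopping_time\<close> requires the times to range over the index set of the
  filtration; here stopping times may take the value \<open>\<infinity>\<close>.
\<close>

definition ext_stopping_time :: "(real \<Rightarrow> 'a measure) \<Rightarrow> ('a \<Rightarrow> ennreal) \<Rightarrow> bool" where
  "ext_stopping_time F T \<longleftrightarrow> (\<forall>t\<ge>0. Measurable.pred (F t) (\<lambda>\<omega>. T \<omega> \<le> ennreal t))"

definition AE_right_continuous :: "'a measure \<Rightarrow> (real \<Rightarrow> 'a \<Rightarrow> real) \<Rightarrow> bool" where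
  "AE_right_continuous M X \<longleftrightarrow> (AE \<omega> in M. \<forall>t\<ge>0. continuous (at_right t) (\<lambda>s. X s \<omega>))"

text \<open>On \<open>{T < \<infinity>}\<close> all \<open>S n\<close> are finite, so \<^const>\<open>enn2real\<close> is only used on finite times.\<close>

definition quasi_left_continuous ::
  "'a measure \<Rightarrow> (real \<Rightarrow> 'a measure) \<Rightarrow> (real \<Rightarrow> 'a \<Rightarrow> real) \<Rightarrow> bool" where
  "quasi_left_continuous M F X \<longleftrightarrow>
    (\<forall>S T. (\<forall>n. ext_stopping_time F (S n)) \<longrightarrow>
      (\<forall>n. \<forall>\<omega>\<in>space M. S n \<omega> \<le> S (Suc n) \<omega>) \<longrightarrow>
      (\<forall>\<omega>\<in>space M. (\<lambda>n. S n \<omega>) \<longlonglongrightarrow> T \<omega>) \<longrightarrow>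
      (AE \<omega> in M. T \<omega> < \<infinity> \<longrightarrow>
        (\<lambda>n. X (enn2real (S n \<omega>)) \<omega>) \<longlonglongrightarrow> X (enn2real (T \<omega>)) \<omega>))"

text \<open>
  Atoms in the measure-theoretic sense, for finite measures.  For Borel probability measures on
  the real line, having no atoms amounts to giving mass 0 to every point.
\<close>

definition atom :: "'a measure \<Rightarrow> 'a set \<Rightarrow> bool" where
  "atom \<mu> A \<longleftrightarrow> A \<in> sets \<mu> \<and> emeasure \<mu> A > 0 \<and>
    (\<forall>B\<in>sets \<mu>. B \<subseteq> A \<longrightarrow> emeasure \<mu> B = 0 \<or> emeasure \<mu> B = emeasure \<mu> A)"

definition diffuse :: "'a measure \<Rightarrow> bool" where
  "diffuse \<mu> \<longleftrightarrow> (\<nexists>A. atom \<mu> A)"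

definition lower_semicontinuous ::
  "('a::topological_space \<Rightarrow> 'b::{complete_linorder, linorder_topology}) \<Rightarrow> bool" where
  "lower_semicontinuous f \<longleftrightarrow> (\<forall>x. f x \<le> Liminf (at x) f)"

text \<open>\<open>[0,\<infinity>]\<close> is \<^typ>\<open>ennreal\<close> and \<open>[-\<infinity>,\<infinity>]\<close> is \<^typ>\<open>ereal\<close>.\<close>

definition boundary_function :: "(ennreal \<Rightarrow> ereal) \<Rightarrow> bool" where
  "boundary_function b \<longleftrightarrow> lower_semicontinuous b"

text \<open>In \<^typ>\<open>ennreal\<close> the infimum of the empty set is \<open>\<infinity>\<close>.\<close>

definition hitting_time :: "(real \<Rightarrow> 'a \<Rightarrow> real) \<Rightarrow> (ennreal \<Rightarrow> ereal) \<Rightarrow> 'a \<Rightarrow> ennreal" where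
  "hitting_time X b \<omega> = Inf {ennreal t | t. t > 0 \<and> ereal (X t \<omega>) \<ge> b (ennreal t)}"

definition crossing_time :: "(real \<Rightarrow> 'a \<Rightarrow> real) \<Rightarrow> (ennreal \<Rightarrow> ereal) \<Rightarrow> 'a \<Rightarrow> ennreal" where
  "crossing_time X b \<omega> = Inf {ennreal t | t. t > 0 \<and> ereal (X t \<omega>) > b (ennreal t)}"

end

theory Submission
  imports Defs "HOL-Library.Diagonal_Subsequence"
begin

text \<open>
  On the grid of times \<open>k / 2\<^sup>n\<close> (with value \<open>\<infinity>\<close> elsewhere) the levels of a boundary can be chosen one
  after the other, by diffuseness, so that its hitting time has the law of \<open>\<xi>\<close> on the grid.  Lower
  semicontinuous functions are sequentially compact under epi-convergence, so a subsequence of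
  these boundaries has a limit \<open>b\<close>.  Hitting a discrete boundary infinitely often before \<open>t\<close> forces
  \<open>b\<close> to be hit by time \<open>t\<close>, by quasi-left-continuity; conversely, crossing \<open>b\<close> before \<open>t\<close>
  forces, up to small probability, the discrete boundaries to be hit before \<open>t\<close>.  Since
  hitting and crossing times of \<open>b\<close> agree, its hitting time has the law of \<open>\<xi>\<close>.
\<close>

subsection \<open>Epi-convergence and countable approximation\<close>

text \<open>Hitting a boundary means that the graph of the path enters its epigraph, a closed set by
  lower semicontinuity; hence the limit of boundaries is taken in the sense of epigraphs and not
  pointwise. The two directions need different inequalities: limits of hits are only weak hits
  \<open>X \<ge> b\<close>, whereas the limit boundary can be traced back to its approximations only
  where it is strictly exceeded, because a strict excess survives small errors in time and level. So
  one gets a lower bound for the law of the hitting time and an upper bound for the law of the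
  crossing time, and \<open>E3\<close> joins them. It also yields measurability, since strict
  crossing is decided by countably many times up to a null set. The delicate point is the origin:
  hits may accumulate at time 0, which hitting times do not count. Positivity of
  \<open>\<xi>\<close> controls this loss, as the mass prescribed on short initial intervals tends
  to 0.\<close>

lemma diagonal_convergent_subseq:
  fixes f :: "nat \<Rightarrow> nat \<Rightarrow> 'b::{complete_linorder, linorder_topology, first_countable_topology}"
  obtains r where "strict_mono r" "\<And>i. convergent (\<lambda>n. f (r n) i)"
proof -
  let ?P = "\<lambda>i s. convergent (\<lambda>n. f (s n) i)"
  interpret subseqs ?P
  proof
    fix i and s :: "nat \<Rightarrow> nat" assume "strict_mono s"
    obtain l r' where "strict_mono r'" "((\<lambda>n. f (s n) i) \<circ> r') \<longlonglongrightarrow> l"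
      using compact_complete_linorder by metis
    then show "\<exists>r'. strict_mono r' \<and> convergent (\<lambda>n. f ((s \<circ> r') n) i)"
      by (auto simp: convergent_def o_def)
  qed
  have "convergent (\<lambda>n. f (diagseq n) i)" for i
  proof -
    \<comment> \<open>From position \<open>Suc i\<close> on, the diagonal sequence is a subsequence
      of the one chosen for coordinate \<open>i\<close>, so convergence there holds up to a finite
      shift.\<close>
    have "convergent (\<lambda>n. f ((diagseq \<circ> ((+) (Suc i))) n) i)"
      by (rule diagseq_holds) (use convergent_subseq_convergent in \<open>fastforce simp: o_def\<close>)
    then have "convergent (\<lambda>n. f (diagseq (n + Suc i)) i)"
      by (simp add: o_def add.commute)
    then obtain L where "(\<lambda>n. f (diagseq (n + Suc i)) i) \<longlonglongrightarrow> L"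
      by (auto simp: convergent_def)
    then have "(\<lambda>n. f (diagseq n) i) \<longlonglongrightarrow> L"
      by (rule LIMSEQ_offset)
    then show ?thesis
      by (auto simp: convergent_def)
  qed
  with subseq_diagseq that show thesis by blast
qed

text \<open>
  Sequential compactness of lower semicontinuous functions under epi-convergence: the limits of the
  infima over the members of a countable basis determine the limit function.
\<close>

lemma epi_convergent_subseq:
  fixes f :: "nat \<Rightarrow> 'a::second_countable_topology \<Rightarrow>
    'b::{complete_linorder, linorder_topology, first_countable_topology}"
  obtains r g where "strict_mono r" "lower_semicontinuous g"
    "\<And>x c. c < g x \<Longrightarrow> \<exists>U. open U \<and> x \<in> U \<and> (\<forall>\<^sub>F n in sequentially. \<forall>y\<in>U. c < f (r n) y)"
    "\<And>x c U. \<lbrakk>g x < c; open U; x \<in> U\<rbrakk> \<Longrightarrow> \<forall>\<^sub>F n in sequentially. \<exists>y\<in>U. f (r n) y < c"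
proof -
  obtain B :: "'a set set" where B: "countable B" "topological_basis B"
    using ex_countable_basis by blast
  define V where "V = from_nat_into B"
  have "B \<noteq> {}"
    using topological_basisE[OF B(2) open_UNIV UNIV_I] by blast
  then have range_V: "range V = B"
    unfolding V_def using B(1) by (rule range_from_nat_into)
  obtain r where r: "strict_mono r" "\<And>i. convergent (\<lambda>n. INF y\<in>V i. f (r n) y)"
    using diagonal_convergent_subseq[of "\<lambda>n i. INF y\<in>V i. f n y"] by blast
  define m where "m i = lim (\<lambda>n. INF y\<in>V i. f (r n) y)" for i
  have m: "(\<lambda>n. INF y\<in>V i. f (r n) y) \<longlonglongrightarrow> m i" for i
    using r(2) unfolding m_def convergent_LIMSEQ_iff .
  \<comment> \<open>This is the lower epi-limit. It is the upper one too because the infima converge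
    on every basis set; a mere liminf of infima would give nearby low values only along a further
    subsequence.\<close>
  define g where "g x = (SUP i\<in>{i. x \<in> V i}. m i)" for x
  have V_open: "open (V i)" for i
    using B(2) range_V topological_basis_open by blast
  have V_basis: "\<exists>i. x \<in> V i \<and> V i \<subseteq> U" if "open U" "x \<in> U" for U x
    using topological_basisE[OF B(2) that] range_V by (metis rangeE)
  have lower: "\<exists>i. x \<in> V i \<and> c < m i" if "c < g x" for c x
    using that unfolding g_def less_SUP_iff by auto
  have upper: "m i \<le> g x" if "x \<in> V i" for i x
    unfolding g_def using that by (auto intro: SUP_upper)
  show thesis
  proof
    show "strict_mono r" by (fact r(1))
    show "lower_semicontinuous g"
      unfolding lower_semicontinuous_def le_Liminf_iff
    proof safe
      fix x c assume "c < g x"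
      then obtain i where i: "x \<in> V i" "c < m i" using lower by blast
      have "\<forall>\<^sub>F y in at x. y \<in> V i"
        using V_open i(1) by (simp add: eventually_at_topological) blast
      then show "\<forall>\<^sub>F y in at x. c < g y"
        by eventually_elim (use i(2) upper in \<open>auto intro: less_le_trans\<close>)
    qed
    show "\<exists>U. open U \<and> x \<in> U \<and> (\<forall>\<^sub>F n in sequentially. \<forall>y\<in>U. c < f (r n) y)" if less: "c < g x" for x c
    proof -
      obtain i where i: "x \<in> V i" "c < m i" using lower[OF less] by blast
      have "\<forall>\<^sub>F n in sequentially. c < (INF y\<in>V i. f (r n) y)"
        using order_tendstoD(1)[OF m i(2)] .
      then have "\<forall>\<^sub>F n in sequentially. \<forall>y\<in>V i. c < f (r n) y"
        by eventually_elim (auto dest: less_INF_D)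
      with V_open i(1) show ?thesis by blast
    qed
    show "\<forall>\<^sub>F n in sequentially. \<exists>y\<in>U. f (r n) y < c" if less: "g x < c" and U: "open U" "x \<in> U" for x c U
    proof -
      obtain i where i: "x \<in> V i" "V i \<subseteq> U" using V_basis[OF U] by blast
      have "m i < c" using upper[OF i(1)] less by (rule le_less_trans)
      then have "\<forall>\<^sub>F n in sequentially. (INF y\<in>V i. f (r n) y) < c"
        using order_tendstoD(2)[OF m] by blast
      then show ?thesis
        by eventually_elim (use i(2) in \<open>auto simp: INF_less_iff\<close>)
    qed
  qed
qed

text \<open>
  Only countably many points lie a rational gap below all values immediately to their right; these,
  together with one point per rational box in which \<open>f\<close> drops below a rational level, form \<open>D\<close>.
\<close>

lemma countable_right_approximation:
  fixes f :: "real \<Rightarrow> ereal"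
  obtains D where "countable D"
    "\<And>s c u. \<lbrakk>f s < c; s < u; s \<notin> D\<rbrakk> \<Longrightarrow> \<exists>d\<in>D. s < d \<and> d < u \<and> f d < c"
proof -
  define S where "S = (\<lambda>(\<rho>, q). {s. s < \<rho> \<and> f s < ereal q \<and> (\<forall>u. s < u \<longrightarrow> u < \<rho> \<longrightarrow> ereal q \<le> f u)})"
  \<comment> \<open>For a box in which \<open>f\<close> stays at or above \<open>q\<close> the
    choice is arbitrary; this only adds harmless points to the countable set
    \<open>D\<close>.\<close>
  define e where "e = (\<lambda>(p, \<rho>, q). SOME u. p < u \<and> u < \<rho> \<and> f u < ereal q)"
  define D where "D = (\<Union>z\<in>\<rat> \<times> \<rat>. S z) \<union> e ` (\<rat> \<times> \<rat> \<times> \<rat>)"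
  have "countable (S z)" for z
  proof -
    \<comment> \<open>The larger of two distinct points of \<open>S z\<close> would lie between the
      smaller one and \<open>\<rho>\<close>, where all values are at least \<open>q\<close>.\<close>
    have "x = y" if "x \<in> S z" "y \<in> S z" for x y
    proof (rule ccontr)
      assume "x \<noteq> y"
      then consider "x < y" | "y < x" by linarith
      then show False
        using that unfolding S_def by cases (fastforce split: prod.splits)+
    qed
    then obtain x where "S z \<subseteq> {x}" by blast
    then show ?thesis by (rule countable_subset) simp
  qed
  then have "countable D"
    unfolding D_def using countable_rat by (intro countable_Un countable_UN countable_image countable_SIGMA) auto
  moreover have "\<exists>d\<in>D. s < d \<and> d < u \<and> f d < c" if s: "f s < c" "s < u" "s \<notin> D" for s c u
  proof -
    obtain q where q: "q \<in> \<rat>" "f s < ereal q" "ereal q < c"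
      using ereal_dense3[OF s(1)] by (metis Rats_of_rat)
    obtain \<rho> where \<rho>: "\<rho> \<in> \<rat>" "s < \<rho>" "\<rho> < u"
      using Rats_dense_in_real[OF s(2)] by blast
    have "s \<notin> S (\<rho>, q)" using s(3) q(1) \<rho>(1) unfolding D_def by blast
    then obtain v where v: "s < v" "v < \<rho>" "f v < ereal q"
      using q(2) \<rho>(2) unfolding S_def by (auto simp: not_le)
    obtain p where p: "p \<in> \<rat>" "s < p" "p < v"
      using Rats_dense_in_real[OF v(1)] by blast
    let ?d = "e (p, \<rho>, q)"
    have "p < ?d \<and> ?d < \<rho> \<and> f ?d < ereal q"
      unfolding e_def prod.case by (rule someI[of _ v]) (use v p in simp)
    moreover have "?d \<in> D" unfolding D_def using p q \<rho> by blast
    ultimately show ?thesis using p(2) \<rho>(3) q(3) by (metis less_trans)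
  qed
  ultimately show thesis by (rule that)
qed

subsection \<open>Levels and limits of probabilities\<close>

lemma diffuse_emeasure_singleton:
  assumes "diffuse \<mu>" "{x} \<in> sets \<mu>"
  shows "emeasure \<mu> {x} = 0"
proof (rule ccontr)
  assume "emeasure \<mu> {x} \<noteq> 0"
  then have "atom \<mu> {x}"
    using assms(2) by (auto simp: atom_def subset_singleton_iff zero_less_iff_neq_zero)
  with assms(1) show False by (auto simp: diffuse_def)
qed

text \<open>Without atoms the cdf is continuous, so intermediate masses come from the intermediate
  value theorem. The level is an extended real because mass 0 and full mass may be missed by every
  real level.\<close>

lemma (in finite_borel_measure) exists_upper_level:
  assumes no_atoms: "\<And>x. measure M {x} = 0" and p: "0 \<le> p" "p \<le> measure M (space M)"
  shows "\<exists>\<beta>::ereal. measure M {x. \<beta> \<le> ereal x} = p"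
proof -
  let ?m = "measure M (space M)"
  consider "p = 0" | "p = ?m" | "0 < p" "p < ?m" using p by linarith
  then show ?thesis
  proof cases
    case 1
    then show ?thesis by (intro exI[of _ \<infinity>]) simp
  next
    case 2
    then show ?thesis by (intro exI[of _ "-\<infinity>"]) (simp add: borel_UNIV)
  next
    case 3
    obtain a where a: "cdf M a < ?m - p"
      using eventually_happens[OF order_tendstoD(2)[OF cdf_lim_at_bot, of "?m - p"]] 3 by auto
    obtain b where b: "?m - p < cdf M b"
      using eventually_happens[OF order_tendstoD(1)[OF cdf_lim_at_top, of "?m - p"]] 3 by auto
    have "a \<le> b" using a b cdf_nondecreasing[of b a] by linarith
    moreover have "continuous_on {a..b} (cdf M)"
      by (intro continuous_at_imp_continuous_on ballI) (simp add: isCont_cdf no_atoms)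
    ultimately obtain x where x: "cdf M x = ?m - p"
      using IVT'[of "cdf M" a "?m - p" b] a b by auto
    have "measure M {..x} = measure M {..<x} + measure M {x}"
      by (subst finite_measure_Union[symmetric]) (auto intro!: arg_cong[of _ _ "measure M"])
    then have "measure M {..<x} = ?m - p"
      using x no_atoms by (simp add: cdf_def)
    moreover have "measure M (space M - {..<x}) = ?m - measure M {..<x}"
      by (rule finite_measure_compl) auto
    moreover have "space M - {..<x} = {y. ereal x \<le> ereal y}"
      by (auto simp: borel_UNIV)
    ultimately show ?thesis by (intro exI[of _ "ereal x"]) simp
  qed
qed

context prob_space
begin

text \<open>Only points outside \<open>A\<close> can add mass. The level is therefore chosen for the
  law of \<open>Y\<close> on the complement of \<open>A\<close>, which has total mass
  \<open>1 - prob A\<close> and inherits the absence of atoms.\<close>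

lemma exists_level:
  assumes [measurable]: "A \<in> events" "Y \<in> borel_measurable M"
    and no_atoms: "\<And>c. prob {\<omega> \<in> space M. Y \<omega> = c} = 0"
    and p: "prob A \<le> p" "p \<le> 1"
  shows "\<exists>\<beta>::ereal. prob (A \<union> {\<omega> \<in> space M. \<beta> \<le> ereal (Y \<omega>)}) = p"
proof -
  let ?R = "restrict_space M (space M - A)"
  let ?D = "distr ?R borel Y"
  have Y: "Y \<in> borel_measurable ?R"
    by (rule measurable_restrict_space1) simp
  interpret R: finite_measure ?R
    by (rule finite_measure_restrict_space) auto
  interpret D\<^sub>0: finite_measure ?D
    by (rule R.finite_measure_distr[OF Y])
  interpret D: finite_borel_measure ?D
    by standard simp
  have D: "measure ?D S = prob {\<omega> \<in> space M - A. Y \<omega> \<in> S}" if [measurable]: "S \<in> sets borel" for S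
    using Y by (subst measure_distr) (auto simp: space_restrict_space measure_restrict_space
      intro!: arg_cong[of _ _ prob])
  have "measure ?D {c} = 0" for c
  proof -
    have "measure ?D {c} \<le> prob {\<omega> \<in> space M. Y \<omega> = c}"
      by (subst D) (auto intro!: finite_measure_mono)
    then show ?thesis using no_atoms measure_nonneg[of ?D "{c}"] by simp
  qed
  moreover have "measure ?D (space ?D) = 1 - prob A"
    by (subst D) (auto simp: prob_compl[symmetric] intro!: arg_cong[of _ _ prob])
  ultimately obtain \<beta> where \<beta>: "measure ?D {x. \<beta> \<le> ereal x} = p - prob A"
    using D.exists_upper_level[of "p - prob A"] p by auto
  have "prob (A \<union> {\<omega> \<in> space M. \<beta> \<le> ereal (Y \<omega>)}) = prob (A \<union> {\<omega> \<in> space M - A. Y \<omega> \<in> {x. \<beta> \<le> ereal x}})"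
    using sets.sets_into_space[of A] by (intro arg_cong[of _ _ prob]) auto
  also have "\<dots> = prob A + prob {\<omega> \<in> space M - A. Y \<omega> \<in> {x. \<beta> \<le> ereal x}}"
    by (rule finite_measure_Union) auto
  also have "\<dots> = p"
    using \<beta> by (subst D[symmetric]) auto
  finally show ?thesis by blast
qed

lemma exists_levels:
  fixes Y :: "nat \<Rightarrow> 'a \<Rightarrow> real"
  assumes meas[measurable]: "\<And>k. 1 \<le> k \<Longrightarrow> Y k \<in> borel_measurable M"
    and no_atoms: "\<And>k c. 1 \<le> k \<Longrightarrow> prob {\<omega> \<in> space M. Y k \<omega> = c} = 0"
    and p: "p 0 = 0" "mono p" "\<And>k. p k \<le> 1"
  obtains \<beta> :: "nat \<Rightarrow> ereal"
  where "\<And>k. prob {\<omega> \<in> space M. \<exists>i\<in>{1..k}. \<beta> i \<le> ereal (Y i \<omega>)} = p k"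
proof -
  \<comment> \<open>The state pairs the event that some level has been reached so far with the
    newest level. The clause for \<open>n = 0\<close> makes the initial event empty and not merely
    null, so that later events are exactly unions; the level at index 0 is a dummy.\<close>
  have "\<exists>f. \<forall>n. (fst (f n) \<in> events \<and> prob (fst (f n)) = p n \<and> (n = 0 \<longrightarrow> fst (f n) = {})) \<and>
    fst (f (Suc n)) = fst (f n) \<union> {\<omega> \<in> space M. (snd (f (Suc n)) :: ereal) \<le> ereal (Y (Suc n) \<omega>)}"
  proof (rule dependent_nat_choice)
    show "\<exists>x. fst x \<in> events \<and> prob (fst x) = p 0 \<and> (0 = (0::nat) \<longrightarrow> fst x = {})"
      using p(1) by (intro exI[of _ "({}, _)"]) auto
  next
    fix x :: "'a set \<times> ereal" and n
    assume x: "fst x \<in> events \<and> prob (fst x) = p n \<and> (n = 0 \<longrightarrow> fst x = {})"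
    then obtain \<beta> where \<beta>: "prob (fst x \<union> {\<omega> \<in> space M. \<beta> \<le> ereal (Y (Suc n) \<omega>)}) = p (Suc n)"
      using exists_level[of "fst x" "Y (Suc n)" "p (Suc n)"] no_atoms p(3) monoD[OF p(2), of n "Suc n"]
      by auto
    have [measurable]: "fst x \<in> events" using x by simp
    show "\<exists>y. (fst y \<in> events \<and> prob (fst y) = p (Suc n) \<and> (Suc n = 0 \<longrightarrow> fst y = {})) \<and>
        fst y = fst x \<union> {\<omega> \<in> space M. snd y \<le> ereal (Y (Suc n) \<omega>)}"
      using \<beta> by (intro exI[of _ "(fst x \<union> {\<omega> \<in> space M. \<beta> \<le> ereal (Y (Suc n) \<omega>)}, \<beta>)"]) auto
  qed
  then obtain f where f: "\<And>n. prob (fst (f n)) = p n" "fst (f 0) = {}"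
    "\<And>n. fst (f (Suc n)) = fst (f n) \<union> {\<omega> \<in> space M. (snd (f (Suc n)) :: ereal) \<le> ereal (Y (Suc n) \<omega>)}"
    by auto
  have "fst (f k) = {\<omega> \<in> space M. \<exists>i\<in>{1..k}. snd (f i) \<le> ereal (Y i \<omega>)}" for k
    by (induction k) (auto simp: f atLeastAtMostSuc_conv)
  with f(1) that[of "\<lambda>i. snd (f i)"] show thesis by metis
qed

lemma prob_tendsto_0:
  assumes [measurable]: "\<And>n. A n \<in> events" and ae: "AE \<omega> in M. \<forall>\<^sub>F n in sequentially. \<omega> \<notin> A n"
  shows "(\<lambda>n. prob (A n)) \<longlonglongrightarrow> 0"
proof -
  have "(\<lambda>n. \<integral>\<omega>. indicator (A n) \<omega> \<partial>M) \<longlonglongrightarrow> (\<integral>\<omega>. 0 \<partial>M :: real)"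
  proof (rule integral_dominated_convergence[where w = "\<lambda>_. 1"])
    show "AE \<omega> in M. (\<lambda>n. indicator (A n) \<omega> :: real) \<longlonglongrightarrow> 0"
      using ae by eventually_elim (auto intro!: tendsto_eventually elim: eventually_mono)
  qed (auto simp: indicator_def)
  then show ?thesis by simp
qed

text \<open>A reverse Fatou lemma for events: almost every point outside \<open>E\<close> lies in
  only finitely many \<open>A n\<close>, so the part of \<open>A n\<close> outside \<open>E\<close>
  loses all its mass.\<close>

lemma prob_ge_of_frequently:
  assumes [measurable]: "\<And>n. A n \<in> events" and E[measurable]: "E \<in> events"
    and p: "\<forall>\<^sub>F n in sequentially. p \<le> prob (A n)"
    and ae: "AE \<omega> in M. (\<exists>\<^sub>F n in sequentially. \<omega> \<in> A n) \<longrightarrow> \<omega> \<in> E"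
  shows "p \<le> prob E"
proof -
  have "(\<lambda>n. prob (A n - E)) \<longlonglongrightarrow> 0"
  proof (rule prob_tendsto_0)
    show "AE \<omega> in M. \<forall>\<^sub>F n in sequentially. \<omega> \<notin> A n - E"
      using ae by eventually_elim (auto simp: frequently_def elim: eventually_mono)
  qed auto
  then have "(\<lambda>n. prob (A n - E) + prob E) \<longlonglongrightarrow> 0 + prob E"
    by (intro tendsto_intros)
  moreover have "\<forall>\<^sub>F n in sequentially. p \<le> prob (A n - E) + prob E"
    using p
  proof eventually_elim
    case (elim n)
    have "prob (A n) \<le> prob ((A n - E) \<union> E)" by (rule finite_measure_mono) auto
    also have "\<dots> \<le> prob (A n - E) + prob E" by (rule measure_Un_le) auto
    finally show ?case using elim by simp
  qed
  ultimately show ?thesis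
    by (auto intro: tendsto_lowerbound)
qed

text \<open>The convergence in \<open>lim\<close> is not uniform in \<open>i\<close>, so errors are
  summed over finite unions only: \<open>n\<close> tends to infinity for a fixed finite union, and
  the finite unions then exhaust the whole.\<close>

lemma prob_UN_le:
  fixes A :: "'i \<Rightarrow> 'a set" and C :: "nat \<Rightarrow> 'a set"
  assumes I: "countable I" and A: "\<And>i. i \<in> I \<Longrightarrow> A i \<in> events" and [measurable]: "\<And>n. C n \<in> events"
    and lim: "\<And>i. i \<in> I \<Longrightarrow> (\<lambda>n. prob (A i - C n)) \<longlonglongrightarrow> 0"
    and C: "\<forall>\<^sub>F n in sequentially. prob (C n) \<le> p"
  shows "prob (\<Union>i\<in>I. A i) \<le> p"
proof (cases "I = {}")
  case True
  then show ?thesis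
    using eventually_happens'[OF sequentially_bot C] by (auto intro: order_trans[OF measure_nonneg])
next
  case False
  define B where "B i = A (from_nat_into I i)" for i
  have I_in: "from_nat_into I i \<in> I" for i using False by (rule from_nat_into)
  have [measurable]: "B i \<in> events" for i unfolding B_def by (intro A I_in)
  have lim_B: "(\<lambda>n. prob (B i - C n)) \<longlonglongrightarrow> 0" for i unfolding B_def by (intro lim I_in)
  have "prob (\<Union>i<N. B i) \<le> p" for N
  proof -
    have "(\<lambda>n. p + (\<Sum>i<N. prob (B i - C n))) \<longlonglongrightarrow> p + (\<Sum>i<N. 0)"
      by (intro tendsto_intros lim_B)
    moreover have "\<forall>\<^sub>F n in sequentially. prob (\<Union>i<N. B i) \<le> p + (\<Sum>i<N. prob (B i - C n))"
      using C
    proof eventually_elim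
      case (elim n)
      have "prob (\<Union>i<N. B i) \<le> prob (C n \<union> (\<Union>i<N. B i - C n))"
        by (rule finite_measure_mono) auto
      also have "\<dots> \<le> prob (C n) + prob (\<Union>i<N. B i - C n)"
        by (rule measure_Un_le) auto
      also have "prob (\<Union>i<N. B i - C n) \<le> (\<Sum>i<N. prob (B i - C n))"
        by (rule finite_measure_subadditive_finite) auto
      finally show ?case using elim by simp
    qed
    ultimately show ?thesis by (auto intro: tendsto_lowerbound)
  qed
  moreover have "(\<lambda>N. prob (\<Union>i<N. B i)) \<longlonglongrightarrow> prob (\<Union>N. \<Union>i<N. B i)"
    by (rule finite_Lim_measure_incseq) (force simp: incseq_def)+
  moreover have "(\<Union>N. \<Union>i<N. B i) = (\<Union>i. B i)" by auto
  moreover have "(\<Union>i. B i) = (\<Union>i\<in>I. A i)"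
    unfolding B_def using range_from_nat_into[OF False I] by (metis image_image)
  ultimately show ?thesis by (auto intro: LIMSEQ_le_const2)
qed

end

subsection \<open>Hitting times of quasi-left-continuous processes\<close>

lemma hitting_time_le: "\<lbrakk>0 < t; b (ennreal t) \<le> ereal (X t \<omega>)\<rbrakk> \<Longrightarrow> hitting_time X b \<omega> \<le> ennreal t"
  unfolding hitting_time_def by (auto intro: Inf_lower)

lemma hitting_time_less_iff:
  "hitting_time X b \<omega> < a \<longleftrightarrow> (\<exists>t>0. ennreal t < a \<and> b (ennreal t) \<le> ereal (X t \<omega>))"
  unfolding hitting_time_def by (auto simp: Inf_less_iff)

lemma crossing_time_less_iff:
  "crossing_time X b \<omega> < a \<longleftrightarrow> (\<exists>t>0. ennreal t < a \<and> b (ennreal t) < ereal (X t \<omega>))"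
  unfolding crossing_time_def by (auto simp: Inf_less_iff)

lemma hitting_time_attained:
  assumes fin: "finite {t. 0 < t \<and> b (ennreal t) \<noteq> \<infinity>}" and less: "hitting_time X b \<omega> < \<infinity>"
  obtains t where "0 < t" "hitting_time X b \<omega> = ennreal t" "b (ennreal t) \<le> ereal (X t \<omega>)"
proof -
  let ?A = "{ennreal t | t. t > 0 \<and> b (ennreal t) \<le> ereal (X t \<omega>)}"
  have "?A \<subseteq> ennreal ` {t. 0 < t \<and> b (ennreal t) \<noteq> \<infinity>}" by auto
  then have "finite ?A" using fin by (rule finite_surj[rotated])
  moreover have "?A \<noteq> {}" using less by (auto simp: hitting_time_less_iff)
  ultimately have "Inf ?A = Min ?A" "Min ?A \<in> ?A"
    by (rule cInf_eq_Min, rule Min_in)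
  then have "hitting_time X b \<omega> \<in> ?A"
    by (simp only: hitting_time_def)
  then obtain t where "0 < t" "hitting_time X b \<omega> = ennreal t" "b (ennreal t) \<le> ereal (X t \<omega>)"
    by blast
  then show thesis by (rule that)
qed

lemma hitting_time_le_iff:
  assumes fin: "finite {t. 0 < t \<and> b (ennreal t) \<noteq> \<infinity>}" and s: "0 \<le> s"
  shows "hitting_time X b \<omega> \<le> ennreal s \<longleftrightarrow> (\<exists>t>0. t \<le> s \<and> b (ennreal t) \<le> ereal (X t \<omega>))"
proof
  assume le: "hitting_time X b \<omega> \<le> ennreal s"
  then have "hitting_time X b \<omega> < \<infinity>"
    using order_le_less_trans[OF _ ennreal_less_top] by simp
  then obtain t where t: "0 < t" "hitting_time X b \<omega> = ennreal t" "b (ennreal t) \<le> ereal (X t \<omega>)"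
    by (rule hitting_time_attained[OF fin])
  then have "t \<le> s" using le s by simp
  with t show "\<exists>t>0. t \<le> s \<and> b (ennreal t) \<le> ereal (X t \<omega>)" by blast
next
  assume "\<exists>t>0. t \<le> s \<and> b (ennreal t) \<le> ereal (X t \<omega>)"
  then obtain t where t: "0 < t" "t \<le> s" "b (ennreal t) \<le> ereal (X t \<omega>)" by blast
  then have "hitting_time X b \<omega> \<le> ennreal t" by (intro hitting_time_le)
  also have "\<dots> \<le> ennreal s" using t(2) by (rule ennreal_leI)
  finally show "hitting_time X b \<omega> \<le> ennreal s" .
qed

locale qlc_process = usual_conditions M F
  for M :: "'a measure" and F :: "real \<Rightarrow> 'a measure" +
  fixes X :: "real \<Rightarrow> 'a \<Rightarrow> real"
  assumes adapted: "adapted F X"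
    and right_continuous: "AE_right_continuous M X"
    and quasi_left_continuous: "quasi_left_continuous M F X"
begin

lemma space_F: "0 \<le> t \<Longrightarrow> space (F t) = space M"
  using subalgebra_F[of t] by (simp add: subalgebra_def)

lemma X_event_F:
  assumes "0 \<le> t" "t \<le> s"
  shows "{\<omega> \<in> space M. c \<le> ereal (X t \<omega>)} \<in> sets (F s)"
proof -
  have [measurable]: "X t \<in> borel_measurable (F t)"
    using adapted assms(1) by (simp add: adapted_def)
  have "{\<omega> \<in> space (F t). c \<le> ereal (X t \<omega>)} \<in> sets (F t)" by measurable
  then show ?thesis
    using sets_F_mono[OF assms] space_F[OF assms(1)] by auto
qed

lemma X_measurable [measurable]: "0 \<le> t \<Longrightarrow> X t \<in> borel_measurable M"
  using measurable_from_subalg[OF subalgebra_F] adapted unfolding adapted_def by blast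

lemma ext_stopping_time_iff:
  "ext_stopping_time F T \<longleftrightarrow> (\<forall>t\<ge>0. {\<omega> \<in> space M. T \<omega> \<le> ennreal t} \<in> sets (F t))"
  unfolding ext_stopping_time_def by (auto simp: pred_def space_F)

lemma ext_stopping_time_const: "ext_stopping_time F (\<lambda>_. c)"
  unfolding ext_stopping_time_def by simp

lemma ext_stopping_time_hitting:
  assumes fin: "finite {t. 0 < t \<and> b (ennreal t) \<noteq> \<infinity>}"
  shows "ext_stopping_time F (hitting_time X b)"
  unfolding ext_stopping_time_iff
proof safe
  fix s :: real assume s: "0 \<le> s"
  let ?G = "{t. 0 < t \<and> b (ennreal t) \<noteq> \<infinity>}"
  have "{\<omega> \<in> space M. hitting_time X b \<omega> \<le> ennreal s} =
      (\<Union>t\<in>{t\<in>?G. t \<le> s}. {\<omega> \<in> space M. b (ennreal t) \<le> ereal (X t \<omega>)})"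
    by (auto simp: hitting_time_le_iff[OF fin s])
  also have "\<dots> \<in> sets (F s)"
    by (intro sets.finite_UN ballI X_event_F finite_subset[OF _ fin]) auto
  finally show "{\<omega> \<in> space M. hitting_time X b \<omega> \<le> ennreal s} \<in> sets (F s)" .
qed

text \<open>An infimum at most \<open>t\<close> need not be attained; it only forces some
  \<open>S m\<close> below each later time. This is decided in every \<open>F s\<close> with
  \<open>s > t\<close>, and right-continuity of the filtration brings it down to
  \<open>F t\<close>.\<close>

lemma ext_stopping_time_INF:
  fixes S :: "nat \<Rightarrow> 'a \<Rightarrow> ennreal"
  assumes S: "\<And>m. ext_stopping_time F (S m)"
  shows "ext_stopping_time F (\<lambda>\<omega>. INF m\<in>I. S m \<omega>)"
  unfolding ext_stopping_time_iff
proof safe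
  fix t :: real assume t: "0 \<le> t"
  have "{\<omega> \<in> space M. (INF m\<in>I. S m \<omega>) \<le> ennreal t} \<in> sets (F s)" if s: "t < s" for s
  proof -
    \<comment> \<open>These times decrease to \<open>t\<close>, start at \<open>s\<close> itself and
      never exceed it, so all events below belong to \<open>F s\<close>.\<close>
    let ?t = "\<lambda>k. t + (s - t) / real (Suc k)"
    have t_less: "t < ?t k" for k using s by simp
    have t_le: "?t k \<le> s" for k
      using s divide_left_mono[of 1 "real (Suc k)" "s - t"] by simp
    have iff: "(INF m\<in>I. S m \<omega>) \<le> ennreal t \<longleftrightarrow> (\<forall>k. \<exists>m\<in>I. S m \<omega> \<le> ennreal (?t k))" for \<omega>
    proof
      assume le: "(INF m\<in>I. S m \<omega>) \<le> ennreal t"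
      show "\<forall>k. \<exists>m\<in>I. S m \<omega> \<le> ennreal (?t k)"
      proof
        fix k
        have "(INF m\<in>I. S m \<omega>) < ennreal (?t k)"
          using le t t_less[of k] by (simp add: le_less_trans ennreal_lessI)
        then show "\<exists>m\<in>I. S m \<omega> \<le> ennreal (?t k)"
          by (auto simp: INF_less_iff intro: less_imp_le)
      qed
    next
      assume *: "\<forall>k. \<exists>m\<in>I. S m \<omega> \<le> ennreal (?t k)"
      have "(\<lambda>k. (s - t) / real (Suc k)) \<longlonglongrightarrow> 0"
        by (rule LIMSEQ_Suc[OF lim_const_over_n])
      then have "(\<lambda>k. ennreal (?t k)) \<longlonglongrightarrow> ennreal (t + 0)"
        by (intro tendsto_ennrealI tendsto_intros)
      moreover have "(INF m\<in>I. S m \<omega>) \<le> ennreal (?t k)" for k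
        using * by (meson INF_lower order_trans)
      ultimately show "(INF m\<in>I. S m \<omega>) \<le> ennreal t"
        by (auto intro: LIMSEQ_le_const)
    qed
    have "{\<omega> \<in> space M. (INF m\<in>I. S m \<omega>) \<le> ennreal t} =
        {\<omega> \<in> space (F s). \<forall>k. \<exists>m\<in>I. S m \<omega> \<le> ennreal (?t k)}"
      using s t by (auto simp: iff space_F)
    also have "\<dots> \<in> sets (F s)"
    proof (intro sets.sets_Collect_countable_All sets.sets_Collect_countable_Bex)
      fix k m
      have t\<^sub>0: "0 \<le> ?t k" using t t_less[of k] by linarith
      have "{\<omega> \<in> space M. S m \<omega> \<le> ennreal (?t k)} \<in> sets (F (?t k))"
        using S t\<^sub>0 unfolding ext_stopping_time_iff by blast
      moreover have "space (F s) = space M" using s t by (intro space_F) simp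
      ultimately show "{\<omega> \<in> space (F s). S m \<omega> \<le> ennreal (?t k)} \<in> sets (F s)"
        using sets_F_mono[OF t\<^sub>0 t_le[of k]] by auto
    qed
    finally show ?thesis .
  qed
  then show "{\<omega> \<in> space M. (INF m\<in>I. S m \<omega>) \<le> ennreal t} \<in> sets (F t)"
    using right_continuous_F[OF t] by auto
qed

text \<open>
  The running infima \<open>T\<^sub>n\<close> of the hitting times of \<open>h m\<close>, \<open>m \<ge> n\<close>, increase to the
  limit inferior \<open>T\<close>.  Either every \<open>T\<^sub>n\<close> is attained, and quasi-left-continuity carries
  \<open>X \<ge> h m\<close> over to \<open>T\<close>; or some \<open>T\<^sub>n\<close> is not attained, and then \<open>T = T\<^sub>n\<close> is a limit from
  the right of hitting times, so that right-continuity suffices.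
\<close>

lemma hitting_time_le_liminf:
  fixes h :: "nat \<Rightarrow> ennreal \<Rightarrow> ereal"
  assumes fin: "\<And>n. finite {t. 0 < t \<and> h n (ennreal t) \<noteq> \<infinity>}"
    and \<epsilon>: "0 < \<epsilon>" "\<And>n t. \<lbrakk>0 < t; t < \<epsilon>\<rbrakk> \<Longrightarrow> h n (ennreal t) = \<infinity>"
    and lower: "\<And>x c. c < g x \<Longrightarrow>
      \<exists>U. open U \<and> x \<in> U \<and> (\<forall>\<^sub>F n in sequentially. \<forall>y\<in>U. c < h n y)"
  shows "AE \<omega> in M. hitting_time X g \<omega> \<le> liminf (\<lambda>n. hitting_time X (h n) \<omega>)"
proof -
  define \<sigma> where "\<sigma> n = hitting_time X (h n)" for n
  define T where "T n \<omega> = (INF m\<in>{n..}. \<sigma> m \<omega>)" for n \<omega>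
  define L where "L \<omega> = (SUP n. T n \<omega>)" for \<omega>
  have T_mono: "T n \<omega> \<le> T n' \<omega>" if "n \<le> n'" for n n' \<omega>
    unfolding T_def by (rule INF_superset_mono) (use that in auto)
  have liminf_eq: "liminf (\<lambda>n. hitting_time X (h n) \<omega>) = L \<omega>" for \<omega>
    by (simp add: L_def T_def \<sigma>_def liminf_SUP_INF)
  have T_lim: "(\<lambda>n. T n \<omega>) \<longlonglongrightarrow> L \<omega>" for \<omega>
    unfolding L_def by (rule LIMSEQ_SUP) (simp add: incseq_def T_mono)
  have "ext_stopping_time F (T n)" for n
    unfolding T_def \<sigma>_def by (intro ext_stopping_time_INF ext_stopping_time_hitting fin)
  then have "AE \<omega> in M. L \<omega> < \<infinity> \<longrightarrow>
      (\<lambda>n. X (enn2real (T n \<omega>)) \<omega>) \<longlonglongrightarrow> X (enn2real (L \<omega>)) \<omega>"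
    using quasi_left_continuous T_mono T_lim unfolding quasi_left_continuous_def by simp
  moreover have "AE \<omega> in M. \<forall>t\<ge>0. continuous (at_right t) (\<lambda>s. X s \<omega>)"
    using right_continuous unfolding AE_right_continuous_def .
  ultimately show ?thesis
  proof eventually_elim
    case (elim \<omega>)
    show ?case
    proof (cases "L \<omega> < \<infinity>")
      case False
      then show ?thesis
        by (simp add: liminf_eq not_less top_unique)
    next
      case True
      define s where "s = enn2real (L \<omega>)"
      have L: "L \<omega> = ennreal s" using True by (simp add: s_def)
      \<comment> \<open>The initial gap \<open>\<epsilon>\<close> keeps the limit time positive; at
        time 0 the boundary cannot be hit.\<close>
      have "ennreal \<epsilon> \<le> \<sigma> m \<omega>" for m
        unfolding \<sigma>_def hitting_time_def
        by (rule Inf_greatest) (use \<epsilon> in \<open>force simp: not_less intro: ennreal_leI leI\<close>)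
      then have "ennreal \<epsilon> \<le> T 0 \<omega>" unfolding T_def by (auto intro: INF_greatest)
      also have "\<dots> \<le> L \<omega>" unfolding L_def by (rule SUP_upper) simp
      finally have s: "0 < s"
        unfolding L using \<epsilon>(1) by (metis ennreal_le_iff2 less_le_trans not_le)
      have "g (ennreal s) \<le> ereal (X s \<omega>)"
      proof (rule ccontr)
        assume "\<not> g (ennreal s) \<le> ereal (X s \<omega>)"
        then obtain c where c: "ereal (X s \<omega>) < ereal c" "ereal c < g (ennreal s)"
          using ereal_dense2[of "ereal (X s \<omega>)" "g (ennreal s)"] by (auto simp: not_le)
        obtain U N where U: "open U" "ennreal s \<in> U" "\<And>n y. \<lbrakk>N \<le> n; y \<in> U\<rbrakk> \<Longrightarrow> ereal c < h n y"
          using lower[OF c(2)] by (auto simp: eventually_sequentially)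
        have "\<forall>\<^sub>F n in sequentially. T n \<omega> \<in> U"
          using topological_tendstoD[OF T_lim U(1)] U(2) L by simp
        moreover have "(\<lambda>n. X (enn2real (T n \<omega>)) \<omega>) \<longlonglongrightarrow> X s \<omega>"
          using elim(1) True by (simp add: s_def)
        then have "\<forall>\<^sub>F n in sequentially. X (enn2real (T n \<omega>)) \<omega> < c"
          using c(1) by (auto dest: order_tendstoD)
        ultimately have "\<forall>\<^sub>F n in sequentially. N \<le> n \<and> T n \<omega> \<in> U \<and> X (enn2real (T n \<omega>)) \<omega> < c"
          using eventually_ge_at_top[of N] by eventually_elim simp
        then obtain n where n: "N \<le> n" "T n \<omega> \<in> U" "X (enn2real (T n \<omega>)) \<omega> < c"
          using eventually_happens'[OF sequentially_bot] by blast
        have T_le: "T n \<omega> \<le> ennreal s" unfolding L[symmetric] L_def by (rule SUP_upper) simp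
        \<comment> \<open>Such a hit contradicts the bound \<open>c < h m\<close> on
          \<open>U\<close>, valid from index \<open>N\<close> on.\<close>
        have "\<exists>m\<ge>n. \<exists>y>0. ennreal y \<in> U \<and> X y \<omega> < c \<and> h m (ennreal y) \<le> ereal (X y \<omega>)"
        proof (cases "\<exists>m\<ge>n. \<sigma> m \<omega> = T n \<omega>")
          case True
          then obtain m where m: "n \<le> m" "\<sigma> m \<omega> = T n \<omega>" by blast
          then have "hitting_time X (h m) \<omega> < \<infinity>"
            using order_le_less_trans[OF T_le ennreal_less_top] by (simp add: \<sigma>_def)
          then obtain y where y: "0 < y" "hitting_time X (h m) \<omega> = ennreal y" "h m (ennreal y) \<le> ereal (X y \<omega>)"
            by (rule hitting_time_attained[OF fin])
          have "T n \<omega> = ennreal y" using m(2) y(2) by (simp add: \<sigma>_def)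
          with m(1) n y show ?thesis by auto
        next
          case False
          \<comment> \<open>If \<open>T n'\<close> were larger, the infimum \<open>T n\<close> would
            be decided by the finitely many indices between \<open>n\<close> and \<open>n'\<close>,
            hence be attained. So the sequence is constant from \<open>n\<close> on.\<close>
          have "T n' \<omega> \<le> T n \<omega>" for n'
          proof (rule ccontr)
            assume "\<not> T n' \<omega> \<le> T n \<omega>"
            then obtain m where m: "n \<le> m" "\<sigma> m \<omega> < T n' \<omega>"
              by (auto simp: not_le T_def[of n] INF_less_iff)
            define J where "J = {n..<n'}"
            have late: "T n' \<omega> \<le> \<sigma> k \<omega>" if "n' \<le> k" for k
              unfolding T_def using that by (auto intro: INF_lower)
            have J: "finite J" "m \<in> J"
              using m late[of m] unfolding J_def by (auto simp: not_le[symmetric])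
            obtain m' where m': "m' \<in> J" "\<And>k. k \<in> J \<Longrightarrow> \<sigma> m' \<omega> \<le> \<sigma> k \<omega>"
              using arg_min_if_finite[OF J(1), of "\<lambda>k. \<sigma> k \<omega>"] J(2) by (metis empty_iff not_le)
            have "\<sigma> m' \<omega> \<le> \<sigma> k \<omega>" if "n \<le> k" for k
              using m'(2)[of k] m'(2)[OF J(2)] m(2) late[of k] that unfolding J_def
              by (cases "k < n'") auto
            then have "\<sigma> m' \<omega> \<le> T n \<omega>" unfolding T_def by (auto intro: INF_greatest)
            moreover have "T n \<omega> \<le> \<sigma> m' \<omega>"
              unfolding T_def using m'(1) by (auto simp: J_def intro: INF_lower)
            ultimately show False using False m'(1) by (auto simp: J_def)
          qed
          then have T_eq: "T n \<omega> = ennreal s"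
            using T_le unfolding L[symmetric] L_def by (auto intro: antisym SUP_least)
          have "((\<lambda>u. X u \<omega>) \<longlongrightarrow> X s \<omega>) (at_right s)"
            using elim(2) s by (auto simp: continuous_within)
          then have "\<forall>\<^sub>F u in at_right s. X u \<omega> < c"
            by (rule order_tendstoD) (use c(1) in simp)
          moreover have "(ennreal \<longlongrightarrow> ennreal s) (at_right s)"
            by (intro tendsto_ennrealI tendsto_ident_at)
          then have "\<forall>\<^sub>F u in at_right s. ennreal u \<in> U"
            using U(1,2) by (rule topological_tendstoD)
          ultimately have "\<forall>\<^sub>F u in at_right s. X u \<omega> < c \<and> ennreal u \<in> U"
            by (rule eventually_conj)
          then obtain v where v: "s < v" "\<And>u. \<lbrakk>s < u; u < v\<rbrakk> \<Longrightarrow> X u \<omega> < c \<and> ennreal u \<in> U"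
            unfolding eventually_at_right_field by blast
          have "T n \<omega> < ennreal v" using T_eq v(1) s by (simp add: ennreal_lessI)
          then obtain m where m: "n \<le> m" "\<sigma> m \<omega> < ennreal v"
            by (auto simp: T_def INF_less_iff)
          then have "hitting_time X (h m) \<omega> < \<infinity>"
            using order.strict_trans[OF _ ennreal_less_top] by (simp add: \<sigma>_def)
          then obtain y where y: "0 < y" "hitting_time X (h m) \<omega> = ennreal y" "h m (ennreal y) \<le> ereal (X y \<omega>)"
            by (rule hitting_time_attained[OF fin])
          have "ennreal s \<le> ennreal y"
            using m(1) y(2) unfolding T_eq[symmetric] T_def \<sigma>_def by (metis INF_lower atLeast_iff)
          moreover have "ennreal y < ennreal v" using m(2) y(2) by (simp add: \<sigma>_def)
          ultimately have "s \<le> y" "y < v" using y(1) s by (auto simp: ennreal_less_iff)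
          then have "X y \<omega> < c \<and> ennreal y \<in> U"
            using v(2)[of y] U(2) c(1) by (cases "y = s") auto
          with m(1) y show ?thesis by auto
        qed
        then obtain m y where "n \<le> m" "ennreal y \<in> U" "X y \<omega> < c" "h m (ennreal y) \<le> ereal (X y \<omega>)"
          by blast
        with U(3)[of m "ennreal y"] n(1) show False by (auto dest: less_le_trans)
      qed
      then have "hitting_time X g \<omega> \<le> L \<omega>"
        unfolding L by (intro hitting_time_le s)
      then show ?thesis by (simp add: liminf_eq)
    qed
  qed
qed

text \<open>Fixed times are stopping times, so quasi-left-continuity rules out a jump at
  \<open>d\<close> almost surely from the left; path right-continuity covers the right. A limit
  along the whole neighbourhood filter is wanted because the times compared with \<open>d\<close>
  will depend on the index of the boundary.\<close>

lemma stochastically_continuous: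
  assumes d: "0 < d"
  shows "((\<lambda>s. prob {\<omega> \<in> space M. c < X d \<omega> \<and> X s \<omega> < c}) \<longlongrightarrow> 0) (nhds d)"
proof -
  let ?A = "\<lambda>s. {\<omega> \<in> space M. c < X d \<omega> \<and> X s \<omega> < c}"
  have seq: "(\<lambda>n. prob (?A (S n))) \<longlonglongrightarrow> 0"
    if pos: "\<And>n::nat. 0 < S n" and lim: "AE \<omega> in M. (\<lambda>n. X (S n) \<omega>) \<longlonglongrightarrow> X d \<omega>" for S
  proof (rule prob_tendsto_0)
    have [measurable]: "X (S n) \<in> borel_measurable M" "X d \<in> borel_measurable M" for n
      using pos[of n] d by auto
    show "?A (S n) \<in> events" for n by measurable
    show "AE \<omega> in M. \<forall>\<^sub>F n in sequentially. \<omega> \<notin> ?A (S n)"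
      using lim
    proof eventually_elim
      case (elim \<omega>)
      show ?case
      proof (cases "c < X d \<omega>")
        case True
        show ?thesis
          using order_tendstoD(1)[OF elim True] by (auto elim: eventually_mono)
      qed auto
    qed
  qed
  have "((\<lambda>s. prob (?A s)) \<longlongrightarrow> 0) (at_left d)"
  proof (rule tendsto_at_left_sequentially[OF d])
    fix S assume S: "\<And>n. S n < d" "\<And>n. 0 < S n" "incseq S" "S \<longlonglongrightarrow> d"
    have S_le: "ennreal (S n) \<le> ennreal (S (Suc n))" for n
      using S(3) by (intro ennreal_leI) (rule incseq_SucD)
    have "AE \<omega> in M. ennreal d < \<infinity> \<longrightarrow>
        (\<lambda>n. X (enn2real (ennreal (S n))) \<omega>) \<longlonglongrightarrow> X (enn2real (ennreal d)) \<omega>"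
      using quasi_left_continuous[unfolded quasi_left_continuous_def, rule_format,
          of "\<lambda>n _. ennreal (S n)" "\<lambda>_. ennreal d"] S
      by (simp add: ext_stopping_time_const S_le tendsto_ennrealI)
    then have "AE \<omega> in M. (\<lambda>n. X (S n) \<omega>) \<longlonglongrightarrow> X d \<omega>"
      using S(2) d by (simp add: less_imp_le)
    with S(2) show "(\<lambda>n. prob (?A (S n))) \<longlonglongrightarrow> 0" by (rule seq)
  qed
  moreover have "((\<lambda>s. prob (?A s)) \<longlongrightarrow> 0) (at_right d)"
  proof (rule tendsto_at_right_sequentially[of d "d + 1"])
    fix S assume S: "\<And>n. d < S n" "S \<longlonglongrightarrow> d"
    have lim: "filterlim S (at_right d) sequentially"
      using S(2) by (simp add: filterlim_at S(1) less_imp_neq[OF S(1), symmetric])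
    have "AE \<omega> in M. (\<lambda>n. X (S n) \<omega>) \<longlonglongrightarrow> X d \<omega>"
      using right_continuous unfolding AE_right_continuous_def
    proof eventually_elim
      case (elim \<omega>)
      with d have "((\<lambda>s. X s \<omega>) \<longlongrightarrow> X d \<omega>) (at_right d)"
        by (auto simp: continuous_within)
      then show ?case using lim by (rule filterlim_compose)
    qed
    moreover have "0 < S n" for n
      using S(1)[of n] d by linarith
    ultimately show "(\<lambda>n. prob (?A (S n))) \<longlonglongrightarrow> 0"
      by (intro seq)
  qed simp
  ultimately have "((\<lambda>s. prob (?A s)) \<longlongrightarrow> 0) (at d)"
    by (simp add: filterlim_split_at)
  moreover have "?A d = {}" by auto
  then have "prob (?A d) = 0" by (simp only: measure_empty)
  ultimately show ?thesis
    using tendsto_at_iff_tendsto_nhds[of "\<lambda>s. prob (?A s)" d] by (simp only:)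
qed

end

subsection \<open>Convergence of hitting times\<close>

text \<open>Finite half-lines suffice: the mass at infinity is what they leave of the total mass
  1.\<close>

lemma prob_measure_eqI_ennreal:
  fixes A B :: "ennreal measure"
  assumes "prob_space A" "prob_space B" and sets: "sets A = sets borel" "sets B = sets borel"
    and eq: "\<And>s. 0 \<le> s \<Longrightarrow> measure A {..ennreal s} = measure B {..ennreal s}"
  shows "A = B"
proof -
  interpret A: prob_space A by fact
  interpret B: prob_space B by fact
  have space: "space A = UNIV" "space B = UNIV"
    using sets by (auto dest: sets_eq_imp_space_eq)
  \<comment> \<open>No open upper ray contains 0, so \<open>UNIV\<close> is adjoined to let the
    generator cover the space.\<close>
  let ?E = "insert UNIV (range greaterThan) :: ennreal set set"
  have E: "sets borel = sigma_sets UNIV ?E"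
  proof -
    have "sets borel = sigma_sets UNIV (range greaterThan :: ennreal set set)"
      unfolding borel_Ioi by (rule sets_measure_of) simp
    also have "\<dots> = sigma_sets UNIV ?E"
      by (rule sigma_sets_eqI) (auto intro: sigma_sets_top)
    finally show ?thesis .
  qed
  show ?thesis
  proof (rule measure_eqI_generator_eq[where E = ?E and \<Omega> = UNIV and A = "\<lambda>_. UNIV"])
    have "{a<..} \<inter> {b<..} = {max a b<..}" for a b :: ennreal by auto
    then show "Int_stable ?E"
      by (auto simp: Int_stable_def)
    show "emeasure A S = emeasure B S" if "S \<in> ?E" for S
    proof -
      have "measure A {a<..} = measure B {a<..}" for a
      proof (cases a)
        case (real s)
        have "{a<..} = UNIV - {..a}" by auto
        then show ?thesis
          using A.prob_compl[of "{..a}"] B.prob_compl[of "{..a}"] eq[of s] real by (simp add: sets space)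
      next
        case top
        then have "{a<..} = {}" by (auto simp: not_less)
        then show ?thesis by simp
      qed
      with that show ?thesis
        using A.emeasure_space_1 B.emeasure_space_1
        by (auto simp: A.emeasure_eq_measure B.emeasure_eq_measure space)
    qed
  qed (use sets E in auto)
qed

lemma (in complete_measure) measurable_AE_eq:
  fixes f g :: "'a \<Rightarrow> 'b::{linorder_topology, second_countable_topology}"
  assumes [measurable]: "f \<in> borel_measurable M" and eq: "AE \<omega> in M. g \<omega> = f \<omega>"
  shows "g \<in> borel_measurable M"
proof (rule borel_measurableI_less)
  fix y
  show "{\<omega> \<in> space M. g \<omega> < y} \<in> sets M"
  proof (rule in_sets_AE)
    show "AE \<omega> in M. \<omega> \<in> {\<omega> \<in> space M. f \<omega> < y} \<longleftrightarrow> \<omega> \<in> {\<omega> \<in> space M. g \<omega> < y}"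
      using eq by eventually_elim auto
  qed auto
qed

context qlc_process
begin

text \<open>A strict crossing with a rational level in between persists for a short while to the
  right, by right-continuity. A crossing outside \<open>D\<close> can thus be moved to a slightly
  later point of \<open>D\<close> at which \<open>g\<close> is still below that level, which
  replaces the uncountably many times by countably many.\<close>

lemma crossing_time_less_AE:
  obtains I :: "(real \<times> real) set" where "countable I"
    "\<And>d c. (d, c) \<in> I \<Longrightarrow> 0 < d \<and> ennreal d < t \<and> g (ennreal d) < ereal c"
    "AE \<omega> in M. crossing_time X g \<omega> < t \<longleftrightarrow> (\<exists>(d, c)\<in>I. c < X d \<omega>)"
proof -
  obtain D where D: "countable D"
    "\<And>s c u. \<lbrakk>g (ennreal s) < c; s < u; s \<notin> D\<rbrakk> \<Longrightarrow> \<exists>d\<in>D. s < d \<and> d < u \<and> g (ennreal d) < c"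
    using countable_right_approximation[of "\<lambda>s. g (ennreal s)"] by blast
  define I where "I = {(d, c) \<in> D \<times> \<rat>. 0 < d \<and> ennreal d < t \<and> g (ennreal d) < ereal c}"
  have "countable I"
    by (rule countable_subset[of _ "D \<times> \<rat>"]) (auto simp: I_def intro: D(1) countable_rat)
  moreover have "0 < d \<and> ennreal d < t \<and> g (ennreal d) < ereal c" if "(d, c) \<in> I" for d c
    using that by (auto simp: I_def)
  moreover have "AE \<omega> in M. crossing_time X g \<omega> < t \<longleftrightarrow> (\<exists>(d, c)\<in>I. c < X d \<omega>)"
    using right_continuous unfolding AE_right_continuous_def
  proof eventually_elim
    case (elim \<omega>)
    show ?case
    proof
      assume "crossing_time X g \<omega> < t"
      then obtain s where s: "0 < s" "ennreal s < t" "g (ennreal s) < ereal (X s \<omega>)"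
        by (auto simp: crossing_time_less_iff)
      obtain c where c: "c \<in> \<rat>" "g (ennreal s) < ereal c" "ereal c < ereal (X s \<omega>)"
        using ereal_dense3[OF s(3)] by (metis Rats_of_rat)
      show "\<exists>(d, c)\<in>I. c < X d \<omega>"
      proof (cases "s \<in> D")
        case True
        with s c have "(s, c) \<in> I" by (simp add: I_def)
        with c(3) show ?thesis by auto
      next
        case False
        have "((\<lambda>u. X u \<omega>) \<longlongrightarrow> X s \<omega>) (at_right s)"
          using elim s(1) by (auto simp: continuous_within)
        then have "\<forall>\<^sub>F u in at_right s. c < X u \<omega>"
          by (rule order_tendstoD) (use c(3) in simp)
        moreover have "(ennreal \<longlongrightarrow> ennreal s) (at_right s)"
          by (intro tendsto_ennrealI tendsto_ident_at)
        then have "\<forall>\<^sub>F u in at_right s. ennreal u < t"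
          using s(2) by (rule order_tendstoD)
        ultimately have "\<forall>\<^sub>F u in at_right s. c < X u \<omega> \<and> ennreal u < t"
          by (rule eventually_conj)
        then obtain v where v: "s < v" "\<And>u. \<lbrakk>s < u; u < v\<rbrakk> \<Longrightarrow> c < X u \<omega> \<and> ennreal u < t"
          unfolding eventually_at_right_field by blast
        obtain d where d: "d \<in> D" "s < d" "d < v" "g (ennreal d) < ereal c"
          using D(2)[OF c(2) v(1) False] by blast
        then have "(d, c) \<in> I" using v(2)[of d] c(1) s(1) by (simp add: I_def)
        with v(2)[of d] d show ?thesis by auto
      qed
    next
      assume "\<exists>(d, c)\<in>I. c < X d \<omega>"
      then obtain d c where "(d, c) \<in> I" "c < X d \<omega>" by auto
      then have "0 < d \<and> ennreal d < t \<and> g (ennreal d) < ereal (X d \<omega>)"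
        by (auto simp: I_def intro: less_trans)
      then show "crossing_time X g \<omega> < t"
        unfolding crossing_time_less_iff by blast
    qed
  qed
  ultimately show thesis by (rule that)
qed

lemma crossing_time_measurable [measurable]: "crossing_time X g \<in> borel_measurable M"
proof (rule borel_measurableI_less)
  fix t
  obtain I :: "(real \<times> real) set" where I: "countable I"
    "\<And>d c. (d, c) \<in> I \<Longrightarrow> 0 < d \<and> ennreal d < t \<and> g (ennreal d) < ereal c"
    "AE \<omega> in M. crossing_time X g \<omega> < t \<longleftrightarrow> (\<exists>(d, c)\<in>I. c < X d \<omega>)"
    using crossing_time_less_AE[where t = t and g = g] by blast
  show "{\<omega> \<in> space M. crossing_time X g \<omega> < t} \<in> events"
  proof (rule in_sets_AE)
    show "AE \<omega> in M. \<omega> \<in> (\<Union>(d, c)\<in>I. {\<omega> \<in> space M. c < X d \<omega>}) \<longleftrightarrow>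
        \<omega> \<in> {\<omega> \<in> space M. crossing_time X g \<omega> < t}"
      using I(3) by eventually_elim auto
    have "{\<omega> \<in> space M. c < X d \<omega>} \<in> events" if "(d, c) \<in> I" for d c
    proof -
      have [measurable]: "X d \<in> borel_measurable M" using I(2)[OF that] by simp
      show ?thesis by measurable
    qed
    then show "(\<Union>(d, c)\<in>I. {\<omega> \<in> space M. c < X d \<omega>}) \<in> events"
      by (intro sets.countable_UN'' I(1)) auto
  qed auto
qed

lemma hitting_time_measurable:
  assumes "finite {t. 0 < t \<and> b (ennreal t) \<noteq> \<infinity>}"
  shows "hitting_time X b \<in> borel_measurable M"
proof (rule borel_measurableI_less)
  fix t
  let ?I = "{s. 0 < s \<and> ennreal s < t \<and> b (ennreal s) \<noteq> \<infinity>}"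
  have "{\<omega> \<in> space M. hitting_time X b \<omega> < t} =
      (\<Union>s\<in>?I. {\<omega> \<in> space M. b (ennreal s) \<le> ereal (X s \<omega>)})"
    by (auto simp: hitting_time_less_iff)
  moreover have "{\<omega> \<in> space M. b (ennreal s) \<le> ereal (X s \<omega>)} \<in> events" if "s \<in> ?I" for s
  proof -
    have [measurable]: "X s \<in> borel_measurable M" using that by simp
    show ?thesis by measurable
  qed
  moreover have "finite ?I" by (rule finite_subset[OF _ assms]) auto
  ultimately show "{\<omega> \<in> space M. hitting_time X b \<omega> < t} \<in> events"
    by (metis (no_types, lifting) sets.finite_UN)
qed

text \<open>If \<open>X d\<close> exceeds \<open>c > g d\<close>, then for large \<open>n\<close>
  some time near \<open>d\<close> has a level of \<open>h n\<close> below \<open>c\<close>. Missing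
  this level forces the path below \<open>c\<close> shortly before or after being above it at
  \<open>d\<close>, which stochastic continuity makes improbable.\<close>

lemma prob_crossing_time_less_le:
  fixes h :: "nat \<Rightarrow> ennreal \<Rightarrow> ereal"
  assumes fin: "\<And>n. finite {t. 0 < t \<and> h n (ennreal t) \<noteq> \<infinity>}"
    and upper: "\<And>x c U. \<lbrakk>g x < c; open U; x \<in> U\<rbrakk> \<Longrightarrow> \<forall>\<^sub>F n in sequentially. \<exists>y\<in>U. h n y < c"
    and p: "\<forall>\<^sub>F n in sequentially. prob {\<omega> \<in> space M. hitting_time X (h n) \<omega> < t} \<le> p"
  shows "prob {\<omega> \<in> space M. crossing_time X g \<omega> < t} \<le> p"
proof -
  obtain I :: "(real \<times> real) set" where I: "countable I"
    "\<And>d c. (d, c) \<in> I \<Longrightarrow> 0 < d \<and> ennreal d < t \<and> g (ennreal d) < ereal c"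
    "AE \<omega> in M. crossing_time X g \<omega> < t \<longleftrightarrow> (\<exists>(d, c)\<in>I. c < X d \<omega>)"
    using crossing_time_less_AE[where t = t and g = g] by blast
  let ?A = "\<lambda>i. {\<omega> \<in> space M. snd i < X (fst i) \<omega>}"
  let ?C = "\<lambda>n. {\<omega> \<in> space M. hitting_time X (h n) \<omega> < t}"
  have A: "?A i \<in> events" if "i \<in> I" for i
  proof -
    have [measurable]: "X (fst i) \<in> borel_measurable M" using I(2)[of "fst i" "snd i"] that by simp
    show ?thesis by measurable
  qed
  have "{\<omega> \<in> space M. crossing_time X g \<omega> < t} \<in> events" by measurable
  moreover have "(\<Union>i\<in>I. ?A i) \<in> events" using A I(1) by (intro sets.countable_UN'') auto
  ultimately have "prob {\<omega> \<in> space M. crossing_time X g \<omega> < t} = prob (\<Union>i\<in>I. ?A i)"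
  proof (intro finite_measure_eq_AE)
    show "AE \<omega> in M. \<omega> \<in> {\<omega> \<in> space M. crossing_time X g \<omega> < t} \<longleftrightarrow> \<omega> \<in> (\<Union>i\<in>I. ?A i)"
      using I(3) AE_space by eventually_elim (simp add: case_prod_beta)
  qed
  also have "\<dots> \<le> p"
  proof (rule prob_UN_le[OF I(1) A])
    have [measurable]: "hitting_time X (h n) \<in> borel_measurable M" for n
      by (rule hitting_time_measurable[OF fin])
    show "?C n \<in> events" for n by measurable
    show "\<forall>\<^sub>F n in sequentially. prob (?C n) \<le> p" by (fact p)
    fix i assume "i \<in> I"
    then obtain d c where i: "i = (d, c)" "0 < d" "ennreal d < t" "g (ennreal d) < ereal c"
      using I(2) by (cases i) auto
    have [measurable]: "X d \<in> borel_measurable M" using i(2) by simp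
    show "(\<lambda>n. prob (?A i - ?C n)) \<longlonglongrightarrow> 0"
    proof (rule order_tendstoI)
      fix \<eta> :: real assume "0 < \<eta>"
      then have "\<forall>\<^sub>F s in nhds d. prob {\<omega> \<in> space M. c < X d \<omega> \<and> X s \<omega> < c} < \<eta>"
        using order_tendstoD(2)[OF stochastically_continuous[OF i(2)]] by blast
      moreover have "\<forall>\<^sub>F s in nhds d. ennreal s < t"
        using order_tendstoD(2)[OF tendsto_ennrealI[OF filterlim_ident] i(3)] .
      moreover have "\<forall>\<^sub>F s in nhds d. 0 < s"
        using order_tendstoD(1)[OF filterlim_ident i(2)] .
      ultimately have "\<forall>\<^sub>F s in nhds d. prob {\<omega> \<in> space M. c < X d \<omega> \<and> X s \<omega> < c} < \<eta> \<and>
          ennreal s < t \<and> 0 < s"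
        by eventually_elim simp
      then obtain \<delta> where \<delta>: "0 < \<delta>" "\<And>s. dist s d < \<delta> \<Longrightarrow>
          prob {\<omega> \<in> space M. c < X d \<omega> \<and> X s \<omega> < c} < \<eta> \<and> ennreal s < t \<and> 0 < s"
        unfolding eventually_nhds_metric by blast
      \<comment> \<open>Half the radius puts \<open>?a\<close> itself inside the ball, so it is
        positive and comparisons in \<open>ennreal\<close> reduce to real ones.\<close>
      let ?a = "d - \<delta> / 2" and ?b = "d + \<delta> / 2"
      have a: "0 < ?a" using \<delta>(2)[of ?a] \<delta>(1) by (simp add: dist_real_def)
      have "ennreal d \<in> {ennreal ?a<..<ennreal ?b}"
        using a \<delta>(1) i(2) by (simp add: ennreal_less_iff)
      then have "\<forall>\<^sub>F n in sequentially. \<exists>y\<in>{ennreal ?a<..<ennreal ?b}. h n y < ereal c"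
        using upper[OF i(4) open_greaterThanLessThan] by blast
      then show "\<forall>\<^sub>F n in sequentially. prob (?A i - ?C n) < \<eta>"
      proof eventually_elim
        case (elim n)
        then obtain y where y: "ennreal ?a < y" "y < ennreal ?b" "h n y < ereal c" by auto
        then obtain s where s: "y = ennreal s" "0 \<le> s"
          by (cases y) auto
        have "?a < s" "s < ?b" using y(1,2) a s by (auto simp: ennreal_less_iff)
        then have "dist s d < \<delta>" using \<delta>(1) by (simp add: dist_real_def abs_less_iff)
        then have \<eta>: "prob {\<omega> \<in> space M. c < X d \<omega> \<and> X s \<omega> < c} < \<eta>" "ennreal s < t" "0 < s"
          using \<delta>(2) by auto
        have [measurable]: "X s \<in> borel_measurable M" using s(2) by simp
        have "X s \<omega> < c" if "\<not> hitting_time X (h n) \<omega> < t" for \<omega>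
        proof -
          have "\<not> h n y \<le> ereal (X s \<omega>)"
            using that \<eta>(2,3) unfolding hitting_time_less_iff s(1) by blast
          then have "ereal (X s \<omega>) < h n y" by (simp add: not_le)
          also note y(3)
          finally show ?thesis by simp
        qed
        then have "?A i - ?C n \<subseteq> {\<omega> \<in> space M. c < X d \<omega> \<and> X s \<omega> < c}"
          by (auto simp: i(1))
        then have "prob (?A i - ?C n) \<le> prob {\<omega> \<in> space M. c < X d \<omega> \<and> X s \<omega> < c}"
          by (rule finite_measure_mono) measurable
        with \<eta>(1) show ?case by simp
      qed
    qed (auto intro!: always_eventually less_le_trans[OF _ measure_nonneg])
  qed
  finally show ?thesis .
qed

lemma discrete_boundaries:
  fixes G :: "real \<Rightarrow> real"
  assumes diffuse: "\<And>t. 0 < t \<Longrightarrow> diffuse (distr M borel (X t))"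
    and G: "G 0 = 0" "mono G" "\<And>t. G t \<le> 1"
  obtains f :: "nat \<Rightarrow> ennreal \<Rightarrow> ereal"
  where "\<And>n. finite {t. 0 < t \<and> f n (ennreal t) \<noteq> \<infinity>}"
    "\<And>j k. \<forall>\<^sub>F n in sequentially.
      prob {\<omega> \<in> space M. hitting_time X (f n) \<omega> \<le> ennreal (real k / 2 ^ j)} = G (real k / 2 ^ j)"
proof -
  let ?level = "\<lambda>n (\<beta> :: nat \<Rightarrow> ereal). \<forall>k.
      prob {\<omega> \<in> space M. \<exists>i\<in>{1..k}. \<beta> i \<le> ereal (X (real i / 2 ^ n) \<omega>)} = G (real k / 2 ^ n)"
  have "\<exists>\<beta>. ?level n \<beta>" for n
  proof (rule exists_levels[of "\<lambda>i. X (real i / 2 ^ n)" "\<lambda>k. G (real k / 2 ^ n)"])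
    show "prob {\<omega> \<in> space M. X (real k / 2 ^ n) \<omega> = c} = 0" if "1 \<le> k" for k c
    proof -
      have [measurable]: "X (real k / 2 ^ n) \<in> borel_measurable M" by (rule X_measurable) simp
      have "emeasure (distr M borel (X (real k / 2 ^ n))) {c} = 0"
        using that by (intro diffuse_emeasure_singleton diffuse) auto
      then have "emeasure M (X (real k / 2 ^ n) -` {c} \<inter> space M) = 0"
        by (subst (asm) emeasure_distr) auto
      moreover have "X (real k / 2 ^ n) -` {c} \<inter> space M = {\<omega> \<in> space M. X (real k / 2 ^ n) \<omega> = c}"
        by auto
      ultimately show ?thesis by (simp add: measure_def)
    qed
  qed (use G in \<open>auto simp: mono_def divide_right_mono\<close>)
  then obtain \<beta> where \<beta>: "?level n (\<beta> n)" for n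
    using choice[of ?level] by blast
  \<comment> \<open>The horizon \<open>n\<close> keeps the grid finite, so hitting times are
    attained. The grid omits time 0, where the law of \<open>X\<close> may have atoms.\<close>
  define K where "K n = {1..n * 2 ^ n}" for n :: nat
  \<comment> \<open>On the grid, \<open>enn2real x * 2 ^ n\<close> is exactly the index, so the
    floor recovers it.\<close>
  define f where "f n x = (if x \<in> (\<lambda>k. ennreal (real k / 2 ^ n)) ` K n
    then \<beta> n (nat \<lfloor>enn2real x * 2 ^ n\<rfloor>) else \<infinity>)" for n x
  have f_grid: "f n (ennreal (real k / 2 ^ n)) = \<beta> n k" if "k \<in> K n" for n k
    using that by (simp add: f_def)
  have f_off: "\<exists>k\<in>K n. t = real k / 2 ^ n" if "0 < t" "f n (ennreal t) \<noteq> \<infinity>" for t n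
    using that by (auto simp: f_def split: if_splits)
  have fin: "finite {t. 0 < t \<and> f n (ennreal t) \<noteq> \<infinity>}" for n
    by (rule finite_subset[of _ "(\<lambda>k. real k / 2 ^ n) ` K n"]) (use f_off in \<open>auto simp: K_def\<close>)
  moreover have "\<forall>\<^sub>F n in sequentially.
      prob {\<omega> \<in> space M. hitting_time X (f n) \<omega> \<le> ennreal (real k / 2 ^ j)} = G (real k / 2 ^ j)" for j k
    \<comment> \<open>\<open>n \<ge> j\<close> makes \<open>k / 2 ^ j\<close> a point of the finer
      grid, and \<open>n \<ge> k\<close> puts it within the horizon.\<close>
    using eventually_ge_at_top[of "max j k"]
  proof eventually_elim
    case (elim n)
    define i where "i = k * 2 ^ (n - j)"
    have "(2::real) ^ n = 2 ^ (n - j) * 2 ^ j"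
      using elim by (simp add: power_add[symmetric])
    then have "real i / 2 ^ n = real k / 2 ^ j"
      by (simp add: i_def)
    moreover have "i \<le> n * 2 ^ n"
      unfolding i_def using elim by (intro mult_mono power_increasing) auto
    then have "{\<omega> \<in> space M. hitting_time X (f n) \<omega> \<le> ennreal (real i / 2 ^ n)} =
        {\<omega> \<in> space M. \<exists>l\<in>{1..i}. \<beta> n l \<le> ereal (X (real l / 2 ^ n) \<omega>)}"
    proof -
      have "(\<exists>t>0. t \<le> real i / 2 ^ n \<and> f n (ennreal t) \<le> ereal (X t \<omega>)) \<longleftrightarrow>
          (\<exists>l\<in>{1..i}. \<beta> n l \<le> ereal (X (real l / 2 ^ n) \<omega>))" (is "?L \<longleftrightarrow> ?R") for \<omega>
      proof
        assume ?L
        then obtain t where t: "0 < t" "t \<le> real i / 2 ^ n" "f n (ennreal t) \<le> ereal (X t \<omega>)" by blast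
        then have "f n (ennreal t) \<noteq> \<infinity>" by auto
        with t(1) obtain l where l: "l \<in> K n" "t = real l / 2 ^ n" using f_off by blast
        moreover have "l \<in> {1..i}" using l t(1,2) by (auto simp: K_def divide_le_cancel)
        ultimately show ?R using t(3) f_grid by auto
      next
        assume ?R
        then obtain l where l: "1 \<le> l" "l \<le> i" "\<beta> n l \<le> ereal (X (real l / 2 ^ n) \<omega>)" by auto
        then have "l \<in> K n" using \<open>i \<le> n * 2 ^ n\<close> by (simp add: K_def)
        with l show ?L
          by (intro exI[of _ "real l / 2 ^ n"]) (simp add: f_grid divide_right_mono)
      qed
      then show ?thesis by (simp add: hitting_time_le_iff[OF fin])
    qed
    ultimately show ?case using \<beta>[of n] by simp
  qed
  ultimately show thesis by (rule that)
qed

end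

text \<open>Hits before \<open>\<epsilon>\<close> might drift to time 0 and leave no trace in the
  limit. Erasing them costs at most \<open>q\<close>, and raising the boundaries to
  \<open>\<infinity>\<close> there preserves their lower bounds.\<close>

lemma (in qlc_process) prob_hitting_time_ge:
  fixes h :: "nat \<Rightarrow> ennreal \<Rightarrow> ereal"
  assumes fin: "\<And>n. finite {t. 0 < t \<and> h n (ennreal t) \<noteq> \<infinity>}"
    and lower: "\<And>x c. c < g x \<Longrightarrow>
      \<exists>U. open U \<and> x \<in> U \<and> (\<forall>\<^sub>F n in sequentially. \<forall>y\<in>U. c < h n y)"
    and meas[measurable]: "hitting_time X g \<in> borel_measurable M"
    and t: "0 \<le> t" and \<epsilon>: "0 < \<epsilon>"
    and p: "\<forall>\<^sub>F n in sequentially. p \<le> prob {\<omega> \<in> space M. hitting_time X (h n) \<omega> \<le> ennreal t}"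
    and q: "\<forall>\<^sub>F n in sequentially. prob {\<omega> \<in> space M. hitting_time X (h n) \<omega> \<le> ennreal \<epsilon>} \<le> q"
  shows "p - q \<le> prob {\<omega> \<in> space M. hitting_time X g \<omega> \<le> ennreal t}"
proof -
  define k where "k n x = (if x < ennreal \<epsilon> then \<infinity> else h n x)" for n x
  have fin_k: "finite {t. 0 < t \<and> k n (ennreal t) \<noteq> \<infinity>}" for n
    by (rule finite_subset[OF _ fin[of n]]) (auto simp: k_def)
  note [measurable] = hitting_time_measurable[OF fin] hitting_time_measurable[OF fin_k]
  have liminf: "AE \<omega> in M. hitting_time X g \<omega> \<le> liminf (\<lambda>n. hitting_time X (k n) \<omega>)"
  proof (rule hitting_time_le_liminf[OF fin_k \<epsilon>])
    show "k n (ennreal t) = \<infinity>" if "0 < t" "t < \<epsilon>" for n t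
      using that by (simp add: k_def ennreal_lessI)
    fix x c assume c: "c < g x"
    then have "c < \<infinity>" by (rule less_le_trans) simp
    obtain U where U: "open U" "x \<in> U" "\<forall>\<^sub>F n in sequentially. \<forall>y\<in>U. c < h n y"
      using lower[OF c] by blast
    from U(3) have "\<forall>\<^sub>F n in sequentially. \<forall>y\<in>U. c < k n y"
      by eventually_elim (use \<open>c < \<infinity>\<close> in \<open>auto simp: k_def\<close>)
    with U(1,2) show "\<exists>U. open U \<and> x \<in> U \<and> (\<forall>\<^sub>F n in sequentially. \<forall>y\<in>U. c < k n y)"
      by blast
  qed
  show ?thesis
  proof (rule prob_ge_of_frequently)
    show "\<forall>\<^sub>F n in sequentially. p - q \<le> prob {\<omega> \<in> space M. hitting_time X (k n) \<omega> \<le> ennreal t}"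
      using p q
    proof eventually_elim
      case (elim n)
      let ?H = "\<lambda>b s. {\<omega> \<in> space M. hitting_time X b \<omega> \<le> ennreal s}"
      have "?H (h n) t \<subseteq> ?H (h n) \<epsilon> \<union> ?H (k n) t"
      proof
        fix \<omega> assume \<omega>: "\<omega> \<in> ?H (h n) t"
        then have "hitting_time X (h n) \<omega> \<le> ennreal t" by simp
        then obtain s where s: "0 < s" "s \<le> t" "h n (ennreal s) \<le> ereal (X s \<omega>)"
          unfolding hitting_time_le_iff[OF fin t] by blast
        show "\<omega> \<in> ?H (h n) \<epsilon> \<union> ?H (k n) t"
        proof (cases "s < \<epsilon>")
          case True
          have "hitting_time X (h n) \<omega> \<le> ennreal s" using s(1,3) by (rule hitting_time_le)
          also have "\<dots> \<le> ennreal \<epsilon>" using True by (intro ennreal_leI) simp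
          finally show ?thesis using \<omega> by simp
        next
          case False
          then have "k n (ennreal s) = h n (ennreal s)"
            using s(1) by (simp add: k_def ennreal_less_iff)
          then have "hitting_time X (k n) \<omega> \<le> ennreal s" using s(1,3) by (intro hitting_time_le) simp_all
          also have "\<dots> \<le> ennreal t" using s(2) by (rule ennreal_leI)
          finally show ?thesis using \<omega> by simp
        qed
      qed
      then have "prob (?H (h n) t) \<le> prob (?H (h n) \<epsilon> \<union> ?H (k n) t)"
        by (rule finite_measure_mono) measurable
      also have "\<dots> \<le> prob (?H (h n) \<epsilon>) + prob (?H (k n) t)"
        by (rule measure_Un_le) measurable
      finally show ?case using elim by linarith
    qed
    show "AE \<omega> in M. (\<exists>\<^sub>F n in sequentially. \<omega> \<in> {\<omega> \<in> space M. hitting_time X (k n) \<omega> \<le> ennreal t}) \<longrightarrow>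
        \<omega> \<in> {\<omega> \<in> space M. hitting_time X g \<omega> \<le> ennreal t}"
      using liminf AE_space
    proof eventually_elim
      case (elim \<omega>)
      have "liminf (\<lambda>n. hitting_time X (k n) \<omega>) \<le> ennreal t"
        if freq: "\<exists>\<^sub>F n in sequentially. hitting_time X (k n) \<omega> \<le> ennreal t"
      proof (rule ccontr)
        assume "\<not> ?thesis"
        then have "\<forall>\<^sub>F n in sequentially. ennreal t < hitting_time X (k n) \<omega>"
          by (intro less_LiminfD) (simp add: not_le)
        with freq show False by (simp add: frequently_def not_le)
      qed
      with elim show ?case by (auto intro: order_trans)
    qed
  qed measurable
qed

theorem theorem2p3:
  fixes M :: "'a measure" and F :: "real \<Rightarrow> 'a measure" and X :: "real \<Rightarrow> 'a \<Rightarrow> real"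
    and N :: "'b measure" and \<xi> :: "'b \<Rightarrow> real"
  assumes "usual_conditions M F"
    and "adapted F X"
    and E1: "\<And>t. t > 0 \<Longrightarrow> diffuse (distr M borel (X t))"
    and E2: "AE_right_continuous M X" "quasi_left_continuous M F X"
    and E3: "\<And>b. boundary_function b \<Longrightarrow>
      AE \<omega> in M. hitting_time X b \<omega> = crossing_time X b \<omega>"
    and "prob_space N"
    and "\<xi> \<in> borel_measurable N"
    and "\<And>\<omega>. \<omega> \<in> space N \<Longrightarrow> \<xi> \<omega> > 0"
  shows "\<exists>b. boundary_function b \<and> hitting_time X b \<in> borel_measurable M \<and>
    distr M borel (hitting_time X b) = distr N borel (\<lambda>\<omega>. ennreal (\<xi> \<omega>))"
proof -
  interpret usual_conditions M F by fact
  interpret qlc_process M F X by unfold_locales fact+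
  interpret N: prob_space N by fact
  note [measurable] = \<open>\<xi> \<in> borel_measurable N\<close>
  interpret \<xi>: real_distribution "distr N borel \<xi>"
    by (rule N.real_distribution_distr) measurable
  define G where "G = cdf (distr N borel \<xi>)"
  have G_eq: "G t = measure N {\<omega> \<in> space N. \<xi> \<omega> \<le> t}" for t
    unfolding G_def cdf_def by (subst measure_distr) (auto intro!: arg_cong[of _ _ "measure N"])
  have "{\<omega> \<in> space N. \<xi> \<omega> \<le> 0} = {}" using assms(9) by (auto simp: not_le)
  then have G_0: "G 0 = 0" by (simp only: G_eq measure_empty)
  have G_mono: "mono G" unfolding G_def by (intro monoI \<xi>.cdf_nondecreasing)
  have G_le: "G t \<le> 1" for t unfolding G_def by (rule \<xi>.cdf_bounded_prob)
  have G_right: "(G \<longlongrightarrow> G t) (at_right t)" for t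
    using \<xi>.cdf_is_right_cont[of t] by (simp add: G_def continuous_within)

  obtain f :: "nat \<Rightarrow> ennreal \<Rightarrow> ereal" where f: "\<And>n. finite {t. 0 < t \<and> f n (ennreal t) \<noteq> \<infinity>}"
    "\<And>j k. \<forall>\<^sub>F n in sequentially.
      prob {\<omega> \<in> space M. hitting_time X (f n) \<omega> \<le> ennreal (real k / 2 ^ j)} = G (real k / 2 ^ j)"
    by (rule discrete_boundaries[OF E1 G_0 G_mono G_le], assumption, rule that)
  obtain r b where r: "strict_mono r" and b: "lower_semicontinuous b" and
    lower: "\<And>x c. c < b x \<Longrightarrow> \<exists>U. open U \<and> x \<in> U \<and> (\<forall>\<^sub>F n in sequentially. \<forall>y\<in>U. c < f (r n) y)" and
    upper: "\<And>x c U. \<lbrakk>b x < c; open U; x \<in> U\<rbrakk> \<Longrightarrow> \<forall>\<^sub>F n in sequentially. \<exists>y\<in>U. f (r n) y < c"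
    by (rule epi_convergent_subseq[of f]) (rule that)
  have dyadic: "\<forall>\<^sub>F n in sequentially.
      prob {\<omega> \<in> space M. hitting_time X (f (r n)) \<omega> \<le> ennreal (real k / 2 ^ j)} = G (real k / 2 ^ j)" for j k
    by (rule eventually_subseq[OF r f(2)])
  have bf: "boundary_function b" using b by (simp add: boundary_function_def)
  note eq = E3[OF bf]
  \<comment> \<open>\<open>E3\<close> gives equality with the crossing time only almost surely;
    completeness of \<open>M\<close> carries measurability over.\<close>
  have meas[measurable]: "hitting_time X b \<in> borel_measurable M"
    by (rule measurable_AE_eq[OF crossing_time_measurable eq])

  have ge: "G (real k / 2 ^ j) \<le> prob {\<omega> \<in> space M. hitting_time X b \<omega> \<le> ennreal (real k / 2 ^ j)}"
    (is "_ \<le> ?p") for k j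
  proof -
    \<comment> \<open>The cut-off is dyadic so that the mass lost before it is known exactly for
      large \<open>n\<close>. It tends to \<open>G 0 = 0\<close>, which is where positivity of
      \<open>\<xi>\<close> enters.\<close>
    have "G (real k / 2 ^ j) - G (1 / 2 ^ i) \<le> ?p" for i
    proof (rule prob_hitting_time_ge[OF f(1) lower meas])
      show "\<forall>\<^sub>F n in sequentially. G (real k / 2 ^ j) \<le>
          prob {\<omega> \<in> space M. hitting_time X (f (r n)) \<omega> \<le> ennreal (real k / 2 ^ j)}"
        using dyadic[of k j] by eventually_elim simp
      show "\<forall>\<^sub>F n in sequentially.
          prob {\<omega> \<in> space M. hitting_time X (f (r n)) \<omega> \<le> ennreal (1 / 2 ^ i)} \<le> G (1 / 2 ^ i)"
        using dyadic[of 1 i] by eventually_elim simp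
    qed auto
    moreover have "(\<lambda>i. G (real k / 2 ^ j) - G (1 / 2 ^ i)) \<longlonglongrightarrow> G (real k / 2 ^ j) - G 0"
    proof (intro tendsto_diff tendsto_const filterlim_compose[OF G_right])
      have "(\<lambda>i. (1 / 2 :: real) ^ i) \<longlonglongrightarrow> 0" by (rule LIMSEQ_power_zero) simp
      then show "filterlim (\<lambda>i. 1 / 2 ^ i :: real) (at_right 0) sequentially"
        by (simp add: filterlim_at power_one_over)
    qed
    ultimately show ?thesis unfolding G_0 by (auto intro: LIMSEQ_le_const2)
  qed
  have le: "prob {\<omega> \<in> space M. hitting_time X b \<omega> < ennreal (real k / 2 ^ j)} \<le> G (real k / 2 ^ j)"
    for k j
  proof -
    have "prob {\<omega> \<in> space M. hitting_time X b \<omega> < ennreal (real k / 2 ^ j)} =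
        prob {\<omega> \<in> space M. crossing_time X b \<omega> < ennreal (real k / 2 ^ j)}"
      using eq by (intro finite_measure_eq_AE) (auto elim!: eventually_mono)
    also have "\<dots> \<le> G (real k / 2 ^ j)"
    proof (rule prob_crossing_time_less_le[OF f(1) upper])
      show "\<forall>\<^sub>F n in sequentially.
          prob {\<omega> \<in> space M. hitting_time X (f (r n)) \<omega> < ennreal (real k / 2 ^ j)} \<le> G (real k / 2 ^ j)"
        using dyadic[of k j]
      proof eventually_elim
        case (elim n)
        have [measurable]: "hitting_time X (f (r n)) \<in> borel_measurable M"
          by (rule hitting_time_measurable[OF f(1)])
        have "prob {\<omega> \<in> space M. hitting_time X (f (r n)) \<omega> < ennreal (real k / 2 ^ j)} \<le>
            prob {\<omega> \<in> space M. hitting_time X (f (r n)) \<omega> \<le> ennreal (real k / 2 ^ j)}"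
          by (rule finite_measure_mono) auto
        with elim show ?case by simp
      qed
    qed
    finally show ?thesis .
  qed

  have main: "prob {\<omega> \<in> space M. hitting_time X b \<omega> \<le> ennreal s} = G s" if s: "0 \<le> s" for s
  proof -
    \<comment> \<open>Adding one to the floor makes \<open>t j\<close> strictly larger than
      \<open>s\<close> even for dyadic \<open>s\<close>, as needed to pass from
      \<open>\<le> s\<close> to \<open>< t j\<close> and to approach \<open>s\<close> within
      \<open>at_right s\<close>.\<close>
    define k where "k j = Suc (nat \<lfloor>s * 2 ^ j\<rfloor>)" for j
    define t where "t j = real (k j) / 2 ^ j" for j
    have k: "s * 2 ^ j < real (k j)" "real (k j) \<le> s * 2 ^ j + 1" for j
      using s unfolding k_def by auto linarith
    have t: "s < t j" "t j \<le> s + (1 / 2) ^ j" for j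
      using k[of j] by (simp_all add: t_def field_simps)
    have "(\<lambda>j. s + (1 / 2) ^ j) \<longlonglongrightarrow> s + 0"
      by (intro tendsto_intros LIMSEQ_power_zero) simp
    then have t_lim: "t \<longlonglongrightarrow> s"
      by (intro tendsto_sandwich[of "\<lambda>_. s" t sequentially "\<lambda>j. s + (1 / 2) ^ j"])
        (auto intro!: always_eventually less_imp_le[OF t(1)] t(2))
    have "decseq t"
    proof (rule decseq_SucI)
      fix j
      \<comment> \<open>\<open>k (Suc j)\<close> is the least integer above
        \<open>s * 2 ^ Suc j\<close>, and \<open>2 * k j\<close> is another integer above
        it.\<close>
      have "s * 2 ^ Suc j < real (2 * k j)" using k(1)[of j] by simp
      then have "\<lfloor>s * 2 ^ Suc j\<rfloor> < int (2 * k j)" by (simp add: floor_less_iff)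
      then have "k (Suc j) \<le> 2 * k j" unfolding k_def[of "Suc j"] using s by (simp only: Suc_le_eq) (subst nat_less_iff, auto)
      then have "real (k (Suc j)) \<le> 2 * real (k j)" by linarith
      then show "t (Suc j) \<le> t j" by (simp add: t_def field_simps)
    qed
    have "filterlim t (at_right s) sequentially"
      using t_lim by (simp add: filterlim_at t(1) less_imp_neq[OF t(1), symmetric])
    then have G_lim: "(\<lambda>j. G (t j)) \<longlonglongrightarrow> G s" by (rule filterlim_compose[OF G_right])
    show ?thesis
    proof (rule antisym)
      have "prob {\<omega> \<in> space M. hitting_time X b \<omega> \<le> ennreal s} \<le> G (t j)" for j
      proof -
        have "ennreal s < ennreal (t j)" using s t(1)[of j] by (simp add: ennreal_lessI)
        then have "prob {\<omega> \<in> space M. hitting_time X b \<omega> \<le> ennreal s} \<le>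
            prob {\<omega> \<in> space M. hitting_time X b \<omega> < ennreal (t j)}"
          by (intro finite_measure_mono) (auto intro: le_less_trans)
        also have "\<dots> \<le> G (t j)" unfolding t_def by (rule le)
        finally show ?thesis .
      qed
      then show "prob {\<omega> \<in> space M. hitting_time X b \<omega> \<le> ennreal s} \<le> G s"
        using G_lim by (auto intro: LIMSEQ_le_const)
      let ?H = "\<lambda>j. {\<omega> \<in> space M. hitting_time X b \<omega> \<le> ennreal (t j)}"
      have "(\<lambda>j. prob (?H j)) \<longlonglongrightarrow> prob (\<Inter>j. ?H j)"
      proof (rule finite_Lim_measure_decseq)
        show "decseq ?H"
          using \<open>decseq t\<close> by (auto simp: decseq_def intro: order_trans[OF _ ennreal_leI])
      qed auto
      also have "(\<Inter>j. ?H j) = {\<omega> \<in> space M. hitting_time X b \<omega> \<le> ennreal s}"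
      proof safe
        fix \<omega> assume "\<omega> \<in> (\<Inter>j. ?H j)"
        then show "\<omega> \<in> space M" "hitting_time X b \<omega> \<le> ennreal s"
          using tendsto_ennrealI[OF t_lim] by (auto intro: LIMSEQ_le_const)
      next
        fix \<omega> j assume "hitting_time X b \<omega> \<le> ennreal s"
        then show "hitting_time X b \<omega> \<le> ennreal (t j)"
          using ennreal_leI[OF less_imp_le[OF t(1)]] by (rule order_trans)
      qed
      finally have H_lim: "(\<lambda>j. prob (?H j)) \<longlonglongrightarrow> prob {\<omega> \<in> space M. hitting_time X b \<omega> \<le> ennreal s}" .
      have "G (t j) \<le> prob (?H j)" for j unfolding t_def by (rule ge)
      with G_lim H_lim show "G s \<le> prob {\<omega> \<in> space M. hitting_time X b \<omega> \<le> ennreal s}"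
        by (auto intro: LIMSEQ_le)
    qed
  qed
  have "distr M borel (hitting_time X b) = distr N borel (\<lambda>\<omega>. ennreal (\<xi> \<omega>))"
  proof (rule prob_measure_eqI_ennreal)
    show "prob_space (distr M borel (hitting_time X b))" by (rule prob_space_distr) measurable
    show "prob_space (distr N borel (\<lambda>\<omega>. ennreal (\<xi> \<omega>)))" by (rule N.prob_space_distr) measurable
    fix s :: real assume s: "0 \<le> s"
    have "measure (distr M borel (hitting_time X b)) {..ennreal s} =
        prob {\<omega> \<in> space M. hitting_time X b \<omega> \<le> ennreal s}"
      by (subst measure_distr) (auto intro!: arg_cong[of _ _ prob])
    also have "\<dots> = G s" using s by (rule main)
    also have "\<dots> = measure (distr N borel (\<lambda>\<omega>. ennreal (\<xi> \<omega>))) {..ennreal s}"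
      unfolding G_eq using s by (subst measure_distr) (auto intro!: arg_cong[of _ _ "measure N"])
    finally show "measure (distr M borel (hitting_time X b)) {..ennreal s} =
        measure (distr N borel (\<lambda>\<omega>. ennreal (\<xi> \<omega>))) {..ennreal s}" .
  qed auto
  with bf meas show ?thesis by blast
qed

end
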